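(* The isomorphism $\Phi:FL_2\to FL_1$ has the properties: (i) $\Phi_*[\mathfrak{g}_1]=[\hat{\mathfrak{g}}_1]$, where $[\hat{\mathfrak{g}}_1]$ is the primitive distribution on $FL_1$ for the 6-symmetric space structure determined by $\hat\sigma$; (ii) $\psi_1=\Phi\circ\psi_2$. Therefore $\psi_1$ is primitive harmonic whenever $\psi_2$ is.
   Context: $e_1,e_2,e_3$ is the standard basis of $\mathbb{C}^3$, $v_1\wedge v_2\wedge v_3$ denotes the real oriented 3-plane with real span of $v_1,v_2,v_3$, $(v_1,v_2,v_3)$ is the matrix with these columns, and $\epsilon=e^{2\pi i/3}$. $SL=\{g(e_1\wedge e_2\wedge e_3):g\in SU_3\}$. **Spaces.** $FL_1=\{(v,V)\in S^5\times SL:v\in V\}\cong SU_3/K_1$, with base point $(e_1,e_1\wedge e_2\wedge e_3)$ and $K_1=\{g\in SO_3:ge_1=e_1\}$. $FL_2=\{(w,W)\in S^5\times Gr_{\mathbb{C}}(2,\mathbb{C}^3):w\in W\}$, identified with $N/K_2$, where $N=\{g\in U_3:\det g=-i\}$, $K_2=\{\mathrm{diag}(1,a,a^{-1})\in SU_3\}$, and $nK_2\leftrightarrow(ne_1,\mathrm{Sp}_{\mathbb{C}}\{ne_1,ne_2\})$. **Distributions.** $\mathfrak{g}_1=\left\{\begin{pmatrix}0&0&\alpha\\ \alpha&0&0\\0&\beta&0\end{pmatrix}:\alpha,\beta\in\mathbb{C}\right\}$ is the $(-\epsilon)$-eigenspace on $\mathfrak{sl}_3(\mathbb{C})$ of the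 order six automorphism $\sigma=\mu\nu$, $\nu(g)=SgS^{-1}$, $S=\mathrm{diag}(1,\epsilon,\epsilon^2)$, $\mu(g)=T(g^{-1})^tT^{-1}$, $T$ the permutation matrix fixing $e_1$ and swapping $e_2,e_3$. $[\mathfrak{g}_1]\subset T^{\mathbb{C}}FL_2$ has fibre at $nK_2$ ($n\in N$) the image of $\mathfrak{g}_1$ under the complex linear extension of $X\mapsto\frac{d}{dt}\big|_{0}ne^{tX}K_2$. On $FL_1$ let $\hat\sigma(g)=R(g^{-1})^tR^{-1}$ with $R=\begin{pmatrix}1&0&0\\0&\cos(\pi/3)&\sin(\pi/3)\\0&-\sin(\pi/3)&\cos(\pi/3)\end{pmatrix}$, and $\hat{\mathfrak{g}}_1=\{X\in\mathfrak{sl}_3(\mathbb{C}):-RX^tR^{-1}=-\epsilon X\}$. $[\hat{\mathfrak{g}}_1]\subset T^{\mathbb{C}}FL_1$ has fibre at $gK_1$ ($g\in SU_3$) the image of $\hat{\mathfrak{g}}_1$ under the complex linear extension of $X\mapsto\frac{d}{dt}\big|_{0}ge^{tX}K_1$. A smooth immersion $\psi$ of a Riemann surface is primitive if $d\psi(\partial/\partial z)$ takes values in the relevant distribution; primitive maps are harmonic for any $SU_3$-invariant metric for which that distribution is isotropic, and "primitive harmonic" refers to this. **The map $\Phi$.** $\Phi(w,W)=(v,V)$ with $v=w$ and $V=v\wedge v_1\wedge v_2$, where $$(v,v_1,v_2)=\Bigl(w,\tfrac{1}{\sqrt2}(w_1-w_2),\tfrac{i}{\sqrt2}(w_1+w_2)\Bigr),$$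 and $w,w_1,w_2$ is any unitary basis of $\mathbb{C}^3$ adapted to the flag $\mathrm{Sp}_{\mathbb{C}}\{w\}\subset W\subset\mathbb{C}^3$ (so $W=\mathrm{Sp}_{\mathbb{C}}\{w,w_1\}$) with $\det(w,w_1,w_2)=-i$; this is independent of the choice of such basis. **The maps $\psi_1,\psi_2$.** $f:M\to S^5$ is a minimal Legendrian immersion of a connected oriented surface $M$ (with the induced conformal structure) which is the link of a special Lagrangian cone, i.e. $f\wedge f_x\wedge f_y\in SL$ for oriented conformal coordinates $z=x+iy$. $\psi_1=(f,f\wedge f_x\wedge f_y):M\to FL_1$. $\psi_2=(f,\ell_0\oplus\ell_1):M\to FL_2$, where $\ell_0=\mathrm{Sp}_{\mathbb{C}}\{f\}$ and $\ell_1=\mathrm{Sp}_{\mathbb{C}}\{f_z\}$. *)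

theory Defs
  imports "HOL-Analysis.Analysis"
begin

type_synonym cvec = "complex^3"
type_synonym cmat = "complex^3^3"

definition ctranspose :: "cmat \<Rightarrow> cmat" where
  "ctranspose A = (\<chi> i j. cnj (A $ j $ i))"

definition unitary_group :: "cmat set" where
  "unitary_group = {g. ctranspose g ** g = mat 1}"

definition SU3 :: "cmat set" where
  "SU3 = {g \<in> unitary_group. det g = 1}"

definition smult_mat :: "complex \<Rightarrow> cmat \<Rightarrow> cmat" where
  "smult_mat c A = (\<chi> i j. c * A $ i $ j)"

definition mexp :: "cmat \<Rightarrow> cmat" where
  "mexp X = (\<Sum>n. (1 / fact n) *\<^sub>R (((**) X ^^ n) (mat 1)))"

definition e1 :: cvec where "e1 = axis 1 1"
definition e2 :: cvec where "e2 = axis 2 1"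

definition cols3 :: "cvec \<Rightarrow> cvec \<Rightarrow> cvec \<Rightarrow> cmat" where
  "cols3 a b c = transpose (vector [a, b, c])"

definition eps :: complex where
  "eps = exp (2 * of_real pi * \<i> / 3)"

text \<open>An oriented real 3-plane in complex 3-space is represented by the set of all its positively
  oriented real bases, each basis being the matrix that has it as columns.  So \<open>oplane B\<close> is the
  oriented real span of the columns of \<open>B\<close>, provided these are linearly independent over the reals.\<close>

type_synonym oriented_plane = "cmat set"

definition oplane :: "cmat \<Rightarrow> oriented_plane" where
  "oplane B = {B ** map_matrix complex_of_real A | A :: real^3^3. det A > 0}"

definition wedge3 :: "cvec \<Rightarrow> cvec \<Rightarrow> cvec \<Rightarrow> oriented_plane" where
  "wedge3 a b c = oplane (cols3 a b c)"

text \<open>\<open>span\<close> is the real span; complex spans are written \<open>vec.span\<close>.\<close>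

definition underlying_plane :: "oriented_plane \<Rightarrow> cvec set" where
  "underlying_plane V = (\<Union>B\<in>V. span (columns B))"

definition base_plane :: oriented_plane where
  "base_plane = oplane (mat 1)"

definition SL :: "oriented_plane set" where
  "SL = {(**) g ` base_plane | g. g \<in> SU3}"

type_synonym flag1 = "cvec \<times> oriented_plane"
type_synonym flag2 = "cvec \<times> cvec set"

definition FL1 :: "flag1 set" where
  "FL1 = {(v, V). norm v = 1 \<and> V \<in> SL \<and> v \<in> underlying_plane V}"

definition FL2 :: "flag2 set" where
  "FL2 = {(w, W). norm w = 1 \<and> vec.subspace W \<and> vec.dim W = 2 \<and> w \<in> W}"

definition act1 :: "cmat \<Rightarrow> flag1 \<Rightarrow> flag1" where
  "act1 g p = (g *v fst p, (**) g ` snd p)"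

definition act2 :: "cmat \<Rightarrow> flag2 \<Rightarrow> flag2" where
  "act2 g p = (g *v fst p, (*v) g ` snd p)"

definition N2 :: "cmat set" where
  "N2 = {n \<in> unitary_group. det n = - \<i>}"

definition K1 :: "cmat set" where
  "K1 = {g \<in> SU3. (\<exists>A :: real^3^3. g = map_matrix complex_of_real A) \<and> g *v e1 = e1}"

text \<open>The orbit maps, whose fibres are the cosets of \<open>K1\<close> in \<open>SU3\<close> and the cosets
  \<open>n K2\<close>, \<open>K2 = {diag (1, a, 1/a)}\<close>, in \<open>N2\<close>.  Points of the homogeneous spaces are
  identified with flags through them.\<close>

definition pi1 :: "cmat \<Rightarrow> flag1" where
  "pi1 g = (g *v e1, (**) g ` base_plane)"

definition pi2 :: "cmat \<Rightarrow> flag2" where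
  "pi2 n = (n *v e1, vec.span {n *v e1, n *v e2})"

text \<open>\<open>Ck\<close> and \<open>smooth_on\<close> are only used on open subsets of finite-dimensional spaces.\<close>

primrec Ck :: "nat \<Rightarrow> 'a::real_normed_vector set \<Rightarrow> ('a \<Rightarrow> 'b::real_normed_vector) \<Rightarrow> bool" where
  "Ck 0 U f \<longleftrightarrow> continuous_on U f"
| "Ck (Suc k) U f \<longleftrightarrow> (\<forall>x\<in>U. f differentiable (at x)) \<and>
     (\<forall>v. Ck k U (\<lambda>x. frechet_derivative f (at x) v))"

definition smooth_on :: "'a::real_normed_vector set \<Rightarrow> ('a \<Rightarrow> 'b::real_normed_vector) \<Rightarrow> bool" where
  "smooth_on U f \<longleftrightarrow> (\<forall>k. Ck k U f)"

text \<open>Smooth functions on an embedded submanifold \<open>G\<close> of the space of matrices.\<close>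

definition smooth_fun :: "cmat set \<Rightarrow> (cmat \<Rightarrow> real) \<Rightarrow> bool" where
  "smooth_fun G F \<longleftrightarrow>
     (\<forall>g\<in>G. \<exists>U F'. open U \<and> g \<in> U \<and> smooth_on U F' \<and> (\<forall>x\<in>U \<inter> G. F' x = F x))"

text \<open>The smooth structure of a quotient \<open>G/K\<close> is given by its algebra of smooth real functions:
  those whose pullback to \<open>G\<close> is smooth.  Such functions are total in HOL, but their values
  outside the flag space never matter.\<close>

definition C1 :: "(flag1 \<Rightarrow> real) set" where
  "C1 = {F. smooth_fun SU3 (F \<circ> pi1)}"

definition C2 :: "(flag2 \<Rightarrow> real) set" where
  "C2 = {F. smooth_fun N2 (F \<circ> pi2)}"

text \<open>Tangent vectors are derivations of the algebra \<open>C\<close> of smooth functions.  Throughout, functionals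
  are normalised to be 0 outside \<open>C\<close>, so that equality of functionals is equality on \<open>C\<close>.
  Complex tangent vectors are complex-valued functionals on the real algebra \<open>C\<close>.\<close>

definition tangent_space :: "('p \<Rightarrow> real) set \<Rightarrow> 'p \<Rightarrow> (('p \<Rightarrow> real) \<Rightarrow> real) set" where
  "tangent_space C p = {D. (\<forall>F. F \<notin> C \<longrightarrow> D F = 0) \<and>
     (\<forall>F\<in>C. \<forall>G\<in>C. \<forall>a b. D (\<lambda>x. a * F x + b * G x) = a * D F + b * D G) \<and>
     (\<forall>F\<in>C. \<forall>G\<in>C. D (\<lambda>x. F x * G x) = F p * D G + G p * D F)}"

text \<open>Push-forward of a (real or complex) tangent vector by \<open>\<Phi>\<close>, where \<open>C\<close> is the algebra of the
  target.\<close>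

definition push :: "('q \<Rightarrow> real) set \<Rightarrow> ('p \<Rightarrow> 'q) \<Rightarrow> (('p \<Rightarrow> real) \<Rightarrow> 'v::zero) \<Rightarrow> (('q \<Rightarrow> real) \<Rightarrow> 'v)" where
  "push C \<Phi> D = (\<lambda>F. if F \<in> C then D (F \<circ> \<Phi>) else 0)"

definition diffeomorphism ::
  "('p \<Rightarrow> real) set \<Rightarrow> 'p set \<Rightarrow> ('q \<Rightarrow> real) set \<Rightarrow> 'q set \<Rightarrow> ('p \<Rightarrow> 'q) \<Rightarrow> bool" where
  "diffeomorphism C S C' S' \<Phi> \<longleftrightarrow> bij_betw \<Phi> S S' \<and>
     (\<forall>F\<in>C'. F \<circ> \<Phi> \<in> C) \<and> (\<forall>F\<in>C. F \<circ> inv_into S \<Phi> \<in> C')"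

text \<open>The velocity at \<open>t = 0\<close> of \<open>t \<mapsto> pr (g e\<^sup>t\<^sup>X)\<close> for \<open>X \<in> su(3)\<close>, and its complex linear extension
  to \<open>sl(3,\<complex>)\<close>: here \<open>X = (X - X\<^sup>*)/2 + i \<cdot> (-i/2) (X + X\<^sup>*)\<close> with both \<open>(X - X\<^sup>*)/2\<close> and
  \<open>(-i/2) (X + X\<^sup>*)\<close> in \<open>su(3)\<close>.\<close>

definition velocity ::
  "('p \<Rightarrow> real) set \<Rightarrow> (cmat \<Rightarrow> 'p) \<Rightarrow> cmat \<Rightarrow> cmat \<Rightarrow> ('p \<Rightarrow> real) \<Rightarrow> real" where
  "velocity C pr g X =
     (\<lambda>F. if F \<in> C then deriv (\<lambda>t::real. F (pr (g ** mexp (t *\<^sub>R X)))) 0 else 0)"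

definition cvelocity ::
  "('p \<Rightarrow> real) set \<Rightarrow> (cmat \<Rightarrow> 'p) \<Rightarrow> cmat \<Rightarrow> cmat \<Rightarrow> ('p \<Rightarrow> real) \<Rightarrow> complex" where
  "cvelocity C pr g X = (\<lambda>F.
     of_real (velocity C pr g (smult_mat (1/2) (X - ctranspose X)) F) +
     \<i> * of_real (velocity C pr g (smult_mat (- \<i>/2) (X + ctranspose X)) F))"

definition g1 :: "cmat set" where
  "g1 = {vector [vector [0, 0, \<alpha>], vector [\<alpha>, 0, 0], vector [0, \<beta>, 0]] | \<alpha> \<beta>. True}"

definition Rmat :: cmat where
  "Rmat = vector [vector [1, 0, 0],
                  vector [0, of_real (cos (pi/3)), of_real (sin (pi/3))],
                  vector [0, - of_real (sin (pi/3)), of_real (cos (pi/3))]]"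

definition sigma_hat :: "cmat \<Rightarrow> cmat" where
  "sigma_hat g = Rmat ** transpose (matrix_inv g) ** matrix_inv Rmat"

definition g1_hat :: "cmat set" where
  "g1_hat = {X. trace X = 0 \<and>
     - (Rmat ** transpose X ** matrix_inv Rmat) = smult_mat (- eps) X}"

definition dist2 :: "flag2 \<Rightarrow> ((flag2 \<Rightarrow> real) \<Rightarrow> complex) set" where
  "dist2 p = {cvelocity C2 pi2 n X | n X. n \<in> N2 \<and> pi2 n = p \<and> X \<in> g1}"

definition dist1 :: "flag1 \<Rightarrow> ((flag1 \<Rightarrow> real) \<Rightarrow> complex) set" where
  "dist1 p = {cvelocity C1 pi1 g X | g X. g \<in> SU3 \<and> pi1 g = p \<and> X \<in> g1_hat}"

text \<open>\<open>\<sigma>\<close> makes \<open>G/K\<close> a \<open>k\<close>-symmetric space: it is an automorphism of \<open>G\<close> of order \<open>k\<close>, and \<open>K\<close> lies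
  between its fixed point group and the identity component of the latter.\<close>

definition k_symmetric :: "nat \<Rightarrow> cmat set \<Rightarrow> cmat set \<Rightarrow> (cmat \<Rightarrow> cmat) \<Rightarrow> bool" where
  "k_symmetric k G K \<sigma> \<longleftrightarrow> bij_betw \<sigma> G G \<and>
     (\<forall>a\<in>G. \<forall>b\<in>G. \<sigma> (a ** b) = \<sigma> a ** \<sigma> b) \<and>
     (\<forall>g\<in>G. (\<sigma> ^^ k) g = g) \<and>
     (\<forall>j. 0 < j \<and> j < k \<longrightarrow> (\<exists>g\<in>G. (\<sigma> ^^ j) g \<noteq> g)) \<and>
     connected_component_set {g \<in> G. \<sigma> g = g} (mat 1) \<subseteq> K \<and> K \<subseteq> {g \<in> G. \<sigma> g = g}"

text \<open>\<open>THE\<close> ranges over the values obtained from all admissible bases (here) or charts (in \<open>psi1\<close> and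
  \<open>psi2\<close>); it denotes the intended value because these are independent of the choice.\<close>

definition Phi :: "flag2 \<Rightarrow> flag1" where
  "Phi p = (case p of (w, W) \<Rightarrow>
     (THE q. \<exists>w1 w2. cols3 w w1 w2 \<in> N2 \<and> W = vec.span {w, w1} \<and>
        q = (w, wedge3 w ((1 / of_real (sqrt 2)) *s (w1 - w2)) ((\<i> / of_real (sqrt 2)) *s (w1 + w2)))))"

type_synonym 'm chart = "'m set \<times> ('m \<Rightarrow> complex)"

definition chart_inv :: "'m chart \<Rightarrow> complex \<Rightarrow> 'm" where
  "chart_inv c = inv_into (fst c) (snd c)"

definition chart_image :: "'m chart \<Rightarrow> complex set" where
  "chart_image c = snd c ` fst c"

definition riemann_surface :: "'m::{t2_space, second_countable_topology} chart set \<Rightarrow> bool" where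
  "riemann_surface A \<longleftrightarrow> (\<Union>c\<in>A. fst c) = UNIV \<and>
     (\<forall>c\<in>A. open (fst c) \<and> open (chart_image c) \<and>
        homeomorphism (fst c) (chart_image c) (snd c) (chart_inv c)) \<and>
     (\<forall>c\<in>A. \<forall>c'\<in>A. (snd c' \<circ> chart_inv c) holomorphic_on (snd c ` (fst c \<inter> fst c')))"

text \<open>First and second partial derivatives in a chart; \<open>v = 1\<close> gives the derivative in \<open>x\<close> and
  \<open>v = \<i>\<close> the derivative in \<open>y\<close>, where \<open>z = x + i y\<close>.\<close>

definition pd :: "complex \<Rightarrow> (complex \<Rightarrow> 'b::real_normed_vector) \<Rightarrow> complex \<Rightarrow> 'b" where
  "pd v G z = frechet_derivative G (at z) v"

definition chart_pd :: "'m chart \<Rightarrow> complex \<Rightarrow> ('m \<Rightarrow> 'b::real_normed_vector) \<Rightarrow> 'm \<Rightarrow> 'b" where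
  "chart_pd c v f p = pd v (f \<circ> chart_inv c) (snd c p)"

definition chart_pd2 :: "'m chart \<Rightarrow> complex \<Rightarrow> complex \<Rightarrow> ('m \<Rightarrow> 'b::real_normed_vector) \<Rightarrow> 'm \<Rightarrow> 'b" where
  "chart_pd2 c u v f p = pd u (pd v (f \<circ> chart_inv c)) (snd c p)"

definition immersion_S5 :: "'m chart set \<Rightarrow> ('m \<Rightarrow> cvec) \<Rightarrow> bool" where
  "immersion_S5 A f \<longleftrightarrow> (\<forall>p. norm (f p) = 1) \<and>
     (\<forall>c\<in>A. smooth_on (chart_image c) (f \<circ> chart_inv c) \<and>
        (\<forall>p\<in>fst c. inj (\<lambda>v. chart_pd c v f p)))"

definition conformal :: "'m chart set \<Rightarrow> ('m \<Rightarrow> cvec) \<Rightarrow> bool" where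
  "conformal A f \<longleftrightarrow> (\<forall>c\<in>A. \<forall>p\<in>fst c.
     chart_pd c 1 f p \<bullet> chart_pd c 1 f p = chart_pd c \<i> f p \<bullet> chart_pd c \<i> f p \<and>
     chart_pd c 1 f p \<bullet> chart_pd c \<i> f p = 0)"

text \<open>A Legendrian immersion is tangent to the contact distribution, the kernel of \<open>u \<mapsto> \<langle>i v, u\<rangle>\<close> on the tangent space of the
  sphere at \<open>v\<close>; the inner product is the real one.\<close>

definition legendrian :: "'m chart set \<Rightarrow> ('m \<Rightarrow> cvec) \<Rightarrow> bool" where
  "legendrian A f \<longleftrightarrow> (\<forall>c\<in>A. \<forall>p\<in>fst c. \<forall>v. (\<i> *s f p) \<bullet> chart_pd c v f p = 0)"

text \<open>The second fundamental form of the surface in the 5-sphere is the component of the second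
  derivatives orthogonal to \<open>f\<close> and to the surface (the closest point of a subspace is the
  orthogonal projection onto it); the mean curvature vector is half of its trace with respect to
  the induced metric.\<close>

definition second_ff :: "'m chart \<Rightarrow> ('m \<Rightarrow> cvec) \<Rightarrow> 'm \<Rightarrow> complex \<Rightarrow> complex \<Rightarrow> cvec" where
  "second_ff c f p u v = chart_pd2 c u v f p -
     closest_point (span {f p, chart_pd c 1 f p, chart_pd c \<i> f p}) (chart_pd2 c u v f p)"

definition mean_curvature :: "'m chart \<Rightarrow> ('m \<Rightarrow> cvec) \<Rightarrow> 'm \<Rightarrow> cvec" where
  "mean_curvature c f p =
     (let a = chart_pd c 1 f p; b = chart_pd c \<i> f p; E = a \<bullet> a; F = a \<bullet> b; G = b \<bullet> b
      in (1 / (2 * (E * G - F\<^sup>2))) *\<^sub>R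
           (G *\<^sub>R second_ff c f p 1 1 - (2 * F) *\<^sub>R second_ff c f p 1 \<i> + E *\<^sub>R second_ff c f p \<i> \<i>))"

definition minimal :: "'m chart set \<Rightarrow> ('m \<Rightarrow> cvec) \<Rightarrow> bool" where
  "minimal A f \<longleftrightarrow> (\<forall>c\<in>A. \<forall>p\<in>fst c. mean_curvature c f p = 0)"

definition sl_link :: "'m chart set \<Rightarrow> ('m \<Rightarrow> cvec) \<Rightarrow> bool" where
  "sl_link A f \<longleftrightarrow>
     (\<forall>c\<in>A. \<forall>p\<in>fst c. wedge3 (f p) (chart_pd c 1 f p) (chart_pd c \<i> f p) \<in> SL)"

definition f_z :: "'m chart \<Rightarrow> ('m \<Rightarrow> cvec) \<Rightarrow> 'm \<Rightarrow> cvec" where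
  "f_z c f p = (1/2) *s (chart_pd c 1 f p - \<i> *s chart_pd c \<i> f p)"

definition psi1 :: "'m chart set \<Rightarrow> ('m \<Rightarrow> cvec) \<Rightarrow> 'm \<Rightarrow> flag1" where
  "psi1 A f p = (f p, THE V. \<exists>c\<in>A. p \<in> fst c \<and>
      V = wedge3 (f p) (chart_pd c 1 f p) (chart_pd c \<i> f p))"

definition psi2 :: "'m chart set \<Rightarrow> ('m \<Rightarrow> cvec) \<Rightarrow> 'm \<Rightarrow> flag2" where
  "psi2 A f p = (f p, THE W. \<exists>c\<in>A. p \<in> fst c \<and>
      W = {a + b | a b. a \<in> vec.span {f p} \<and> b \<in> vec.span {f_z c f p}})"

text \<open>From here on \<open>S\<close> is the set of points of the target of a map and \<open>C\<close> its algebra of smooth functions.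
  A map is smooth iff it pulls back smooth functions to smooth functions.\<close>

definition smooth_map :: "('p \<Rightarrow> real) set \<Rightarrow> 'p set \<Rightarrow> 'm chart set \<Rightarrow> ('m \<Rightarrow> 'p) \<Rightarrow> bool" where
  "smooth_map C S A \<psi> \<longleftrightarrow> range \<psi> \<subseteq> S \<and>
     (\<forall>F\<in>C. \<forall>c\<in>A. smooth_on (chart_image c) (F \<circ> \<psi> \<circ> chart_inv c))"

definition diff_map :: "('p \<Rightarrow> real) set \<Rightarrow> 'm chart \<Rightarrow> ('m \<Rightarrow> 'p) \<Rightarrow> 'm \<Rightarrow> complex \<Rightarrow> (('p \<Rightarrow> real) \<Rightarrow> real)" where
  "diff_map C c \<psi> p v = (\<lambda>F. if F \<in> C then chart_pd c v (F \<circ> \<psi>) p else 0)"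

definition diff_z :: "('p \<Rightarrow> real) set \<Rightarrow> 'm chart \<Rightarrow> ('m \<Rightarrow> 'p) \<Rightarrow> 'm \<Rightarrow> (('p \<Rightarrow> real) \<Rightarrow> complex)" where
  "diff_z C c \<psi> p = (\<lambda>F. (of_real (diff_map C c \<psi> p 1 F) - \<i> * of_real (diff_map C c \<psi> p \<i> F)) / 2)"

definition primitive ::
  "('p \<Rightarrow> real) set \<Rightarrow> 'p set \<Rightarrow> ('p \<Rightarrow> (('p \<Rightarrow> real) \<Rightarrow> complex) set) \<Rightarrow>
     'm chart set \<Rightarrow> ('m \<Rightarrow> 'p) \<Rightarrow> bool" where
  "primitive C S \<Delta> A \<psi> \<longleftrightarrow> smooth_map C S A \<psi> \<and>
     (\<forall>c\<in>A. \<forall>p\<in>fst c. inj (diff_map C c \<psi> p) \<and> diff_z C c \<psi> p \<in> \<Delta> (\<psi> p))"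

text \<open>\<open>SU3\<close>-invariant Riemannian metrics.  Smoothness in the point need not be required, as it follows
  from invariance under a transitive action.\<close>

definition invariant_metric ::
  "('p \<Rightarrow> real) set \<Rightarrow> 'p set \<Rightarrow> (cmat \<Rightarrow> 'p \<Rightarrow> 'p) \<Rightarrow>
     ('p \<Rightarrow> (('p \<Rightarrow> real) \<Rightarrow> real) \<Rightarrow> (('p \<Rightarrow> real) \<Rightarrow> real) \<Rightarrow> real) \<Rightarrow> bool" where
  "invariant_metric C S act h \<longleftrightarrow>
     (\<forall>p\<in>S. \<forall>D\<in>tangent_space C p. \<forall>D'\<in>tangent_space C p. h p D D' = h p D' D) \<and>
     (\<forall>p\<in>S. \<forall>D\<in>tangent_space C p. \<forall>D'\<in>tangent_space C p. \<forall>D''\<in>tangent_space C p. \<forall>a b.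
        h p (\<lambda>F. a * D F + b * D' F) D'' = a * h p D D'' + b * h p D' D'') \<and>
     (\<forall>p\<in>S. \<forall>D\<in>tangent_space C p. D \<noteq> (\<lambda>F. 0) \<longrightarrow> h p D D > 0) \<and>
     (\<forall>g\<in>SU3. \<forall>p\<in>S. \<forall>D\<in>tangent_space C p. \<forall>D'\<in>tangent_space C p.
        h (act g p) (push C (act g) D) (push C (act g) D') = h p D D')"

definition complex_bilinear ::
  "((('p \<Rightarrow> real) \<Rightarrow> real) \<Rightarrow> (('p \<Rightarrow> real) \<Rightarrow> real) \<Rightarrow> real) \<Rightarrow>
     (('p \<Rightarrow> real) \<Rightarrow> complex) \<Rightarrow> (('p \<Rightarrow> real) \<Rightarrow> complex) \<Rightarrow> complex" where
  "complex_bilinear h D D' =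
     Complex (h (Re \<circ> D) (Re \<circ> D') - h (Im \<circ> D) (Im \<circ> D')) (h (Re \<circ> D) (Im \<circ> D') + h (Im \<circ> D) (Re \<circ> D'))"

definition isotropic ::
  "'p set \<Rightarrow> ('p \<Rightarrow> (('p \<Rightarrow> real) \<Rightarrow> complex) set) \<Rightarrow>
     ('p \<Rightarrow> (('p \<Rightarrow> real) \<Rightarrow> real) \<Rightarrow> (('p \<Rightarrow> real) \<Rightarrow> real) \<Rightarrow> real) \<Rightarrow> bool" where
  "isotropic S \<Delta> h \<longleftrightarrow> (\<forall>p\<in>S. \<forall>D\<in>\<Delta> p. \<forall>D'\<in>\<Delta> p. complex_bilinear (h p) D D' = 0)"

definition energy ::
  "('p \<Rightarrow> real) set \<Rightarrow> ('p \<Rightarrow> (('p \<Rightarrow> real) \<Rightarrow> real) \<Rightarrow> (('p \<Rightarrow> real) \<Rightarrow> real) \<Rightarrow> real) \<Rightarrow>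
     'm chart \<Rightarrow> complex set \<Rightarrow> ('m \<Rightarrow> 'p) \<Rightarrow> real" where
  "energy C h c K \<psi> = integral K (\<lambda>z. let p = chart_inv c z in
     (h (\<psi> p) (diff_map C c \<psi> p 1) (diff_map C c \<psi> p 1) +
      h (\<psi> p) (diff_map C c \<psi> p \<i>) (diff_map C c \<psi> p \<i>)) / 2)"

text \<open>Harmonic maps are the critical points of the energy under smooth variations with compact
  support.  Since this is a local condition it suffices to use variations supported in a single
  chart.\<close>

definition variation ::
  "('p \<Rightarrow> real) set \<Rightarrow> 'p set \<Rightarrow> 'm chart set \<Rightarrow> ('m \<Rightarrow> 'p) \<Rightarrow> 'm set \<Rightarrow> real \<Rightarrow>
     (real \<Rightarrow> 'm \<Rightarrow> 'p) \<Rightarrow> bool" where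
  "variation C S A \<psi> Q \<delta> \<Psi> \<longleftrightarrow> \<delta> > 0 \<and> \<Psi> 0 = \<psi> \<and>
     (\<forall>t\<in>{-\<delta><..<\<delta>}. range (\<Psi> t) \<subseteq> S \<and> (\<forall>p. p \<notin> Q \<longrightarrow> \<Psi> t p = \<psi> p)) \<and>
     (\<forall>F\<in>C. \<forall>c\<in>A. smooth_on ({-\<delta><..<\<delta>} \<times> chart_image c) (\<lambda>(t, z). F (\<Psi> t (chart_inv c z))))"

definition harmonic ::
  "('p \<Rightarrow> real) set \<Rightarrow> 'p set \<Rightarrow> ('p \<Rightarrow> (('p \<Rightarrow> real) \<Rightarrow> real) \<Rightarrow> (('p \<Rightarrow> real) \<Rightarrow> real) \<Rightarrow> real) \<Rightarrow>
     'm chart set \<Rightarrow> ('m \<Rightarrow> 'p) \<Rightarrow> bool" where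
  "harmonic C S h A \<psi> \<longleftrightarrow> smooth_map C S A \<psi> \<and>
     (\<forall>c\<in>A. \<forall>K. compact K \<and> K \<subseteq> chart_image c \<longrightarrow>
        (\<forall>\<delta> \<Psi>. variation C S A \<psi> (chart_inv c ` K) \<delta> \<Psi> \<longrightarrow>
           ((\<lambda>t. energy C h c K (\<Psi> t)) has_real_derivative 0) (at 0)))"

definition primitive_harmonic ::
  "('p \<Rightarrow> real) set \<Rightarrow> 'p set \<Rightarrow> (cmat \<Rightarrow> 'p \<Rightarrow> 'p) \<Rightarrow> ('p \<Rightarrow> (('p \<Rightarrow> real) \<Rightarrow> complex) set) \<Rightarrow>
     'm chart set \<Rightarrow> ('m \<Rightarrow> 'p) \<Rightarrow> bool" where
  "primitive_harmonic C S act \<Delta> A \<psi> \<longleftrightarrow> primitive C S \<Delta> A \<psi> \<and>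
     (\<forall>h. invariant_metric C S act h \<and> isotropic S \<Delta> h \<longrightarrow> harmonic C S h A \<psi>)"

end

theory Submission
  imports Defs
begin

text \<open>Let \<open>P\<close> be the unitary matrix with columns \<open>e1\<close>, \<open>(e2 - e3)/sqrt 2\<close> and \<open>\<i>(e2 + e3)/sqrt 2\<close>.
  A point of \<open>FL2\<close> is the flag of an adapted unitary frame \<open>n \<in> N2\<close>, and \<open>\<Phi>\<close> sends it to the flag of
  the frame \<open>n P\<close>; since \<open>det P = \<i>\<close>, this frame lies in \<open>SU3\<close>.  So \<open>\<Phi>\<close> is right translation by \<open>P\<close>, read
  on quotients, and everything follows from how conjugation by \<open>P\<close> acts.

  Conjugation by \<open>P\<close> carries \<open>K1\<close> to \<open>K2\<close> (\<open>K1_eq\<close>), because \<open>diag(a, 1/a)\<close> with \<open>\<bar>a\<bar> = 1\<close> becomes a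
  real rotation in the unitary basis given by the last two columns of \<open>P\<close>.  As the
  fibres of the orbit maps are the cosets of \<open>K1\<close> and \<open>K2\<close>, \<open>\<Phi>\<close> is well defined and bijective
  (\<open>pi1_frame_change_eq_iff\<close>, \<open>Phi_bij\<close>).  It commutes with left translations and, right
  translation by \<open>P\<close> being linear, it identifies the smooth functions on the two sides
  (\<open>Phi_diffeomorphism\<close>).  The curve \<open>n exp(t X)\<close> is carried to \<open>n P exp(t P\<^sup>* X P)\<close>, where
  \<open>P\<^sup>*\<close> is the inverse of \<open>P\<close>, so property (i) amounts to the identity that \<open>P\<^sup>* X P\<close> lies in \<open>g1_hat\<close>
  exactly when \<open>X\<close> lies in \<open>g1\<close> (\<open>g1_hat_conj_iff\<close>).

  For property (ii), being the link of a special Lagrangian cone means that \<open>f\<close>, \<open>f\<^sub>x\<close>, \<open>f\<^sub>y\<close> are real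
  combinations of the columns of one matrix in \<open>SU3\<close>.  Their Hermitian products are therefore real and agree
  with their real inner products, so conformality and \<open>\<bar>f\<bar> = 1\<close> make \<open>h = (f, f\<^sub>x/\<bar>f\<^sub>x\<bar>, f\<^sub>y/\<bar>f\<^sub>x\<bar>)\<close> an
  element of \<open>SU3\<close> (\<open>special_lagrangian_frame\<close>).  It is a frame of \<open>\<psi>\<^sub>1\<close>, and the second column of
  \<open>h P\<^sup>*\<close> is a multiple of \<open>f\<^sub>x - \<i> f\<^sub>y\<close>, so \<open>h P\<^sup>*\<close> is a frame of \<open>\<psi>\<^sub>2\<close>.

  Finally, primitivity and harmonicity are expressed through the algebras of smooth functions,
  hence are preserved by a diffeomorphism that matches the distributions and the actions: an
  invariant metric on the target pulls back to an invariant metric on the source with the same energies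
  (\<open>primitive_harmonic_compose\<close>).\<close>

section \<open>Matrices and the change of frame\<close>

lemma mat3_eq_iff:
  fixes A B :: "'a^3^3"
  shows "A = B \<longleftrightarrow>
    A$1$1 = B$1$1 \<and> A$1$2 = B$1$2 \<and> A$1$3 = B$1$3 \<and>
    A$2$1 = B$2$1 \<and> A$2$2 = B$2$2 \<and> A$2$3 = B$2$3 \<and>
    A$3$1 = B$3$1 \<and> A$3$2 = B$3$2 \<and> A$3$3 = B$3$3"
  by (auto simp: vec_eq_iff forall_3)

lemma matrix_mult_nth3:
  fixes A B :: "'a::semiring_1^3^3"
  shows "(A ** B)$i$j = A$i$1 * B$1$j + A$i$2 * B$2$j + A$i$3 * B$3$j"
  by (simp add: matrix_matrix_mult_def sum_3)

lemma matrix_vector_nth3: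
  fixes A :: "'a::semiring_1^3^3"
  shows "(A *v x)$i = A$i$1 * x$1 + A$i$2 * x$2 + A$i$3 * x$3"
  by (simp add: matrix_vector_mult_def sum_3)

lemma ctranspose_nth [simp]: "ctranspose A $ i $ j = cnj (A $ j $ i)"
  by (simp add: ctranspose_def)

lemma ctranspose_mult: "ctranspose (A ** B) = ctranspose B ** ctranspose A"
  by (simp add: vec_eq_iff matrix_matrix_mult_def mult.commute)

lemma ctranspose_ctranspose [simp]: "ctranspose (ctranspose A) = A"
  by (simp add: vec_eq_iff)

lemma ctranspose_one [simp]: "ctranspose (mat 1) = mat 1"
  by (simp add: vec_eq_iff mat_def)

lemma det_ctranspose: "det (ctranspose A) = cnj (det A)"
  by (simp add: det_3 algebra_simps)

lemma unitary_left: "g \<in> unitary_group \<Longrightarrow> ctranspose g ** g = mat 1"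
  by (simp add: unitary_group_def)

lemma unitary_right: "g \<in> unitary_group \<Longrightarrow> g ** ctranspose g = mat 1"
  using matrix_left_right_inverse by (auto simp: unitary_group_def)

lemma unitary_cancel:
  assumes "g \<in> unitary_group"
  shows "ctranspose g ** (g ** A) = A" "g ** (ctranspose g ** A) = A"
    "A ** g ** ctranspose g = A" "A ** ctranspose g ** g = A"
  using unitary_left[OF assms] unitary_right[OF assms]
  by (simp_all add: matrix_mul_assoc) (simp_all flip: matrix_mul_assoc)

lemma unitary_mult: "g \<in> unitary_group \<Longrightarrow> h \<in> unitary_group \<Longrightarrow> g ** h \<in> unitary_group"
  by (auto simp: unitary_group_def ctranspose_mult)
     (metis matrix_mul_assoc matrix_mul_lid)

lemma unitary_ctranspose: "g \<in> unitary_group \<Longrightarrow> ctranspose g \<in> unitary_group"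
  using unitary_right by (auto simp: unitary_group_def)

lemma SU3_mult: "g \<in> SU3 \<Longrightarrow> h \<in> SU3 \<Longrightarrow> g ** h \<in> SU3"
  by (auto simp: SU3_def unitary_mult det_mul)

lemma SU3_ctranspose: "g \<in> SU3 \<Longrightarrow> ctranspose g \<in> SU3"
  by (auto simp: SU3_def unitary_ctranspose det_ctranspose)

lemma SU3_unitary: "g \<in> SU3 \<Longrightarrow> g \<in> unitary_group"
  and N2_unitary: "n \<in> N2 \<Longrightarrow> n \<in> unitary_group"
  by (auto simp: SU3_def N2_def)

lemma SU3_mult_N2: "g \<in> SU3 \<Longrightarrow> n \<in> N2 \<Longrightarrow> g ** n \<in> N2"
  and N2_mult_SU3: "g \<in> SU3 \<Longrightarrow> n \<in> N2 \<Longrightarrow> n ** g \<in> N2"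
  by (auto simp: N2_def SU3_def unitary_mult det_mul)

lemma N2_quotient: "m \<in> N2 \<Longrightarrow> n \<in> N2 \<Longrightarrow> ctranspose m ** n \<in> SU3"
  by (auto simp: N2_def SU3_def unitary_mult unitary_ctranspose det_mul det_ctranspose)

abbreviation cplx :: "real^3^3 \<Rightarrow> cmat" where
  "cplx A \<equiv> map_matrix complex_of_real A"

lemma cplx_mult: "cplx (A ** B) = cplx A ** cplx B"
  by (simp add: vec_eq_iff matrix_matrix_mult_def)

lemma cplx_one [simp]: "cplx (mat 1) = mat 1"
  by (simp add: vec_eq_iff mat_def)

lemma det_cplx: "det (cplx A) = of_real (det A)"
  by (simp add: det_3)

lemma ctranspose_cplx: "ctranspose (cplx A) = cplx (transpose A)"
  by (simp add: vec_eq_iff transpose_def)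

lemma cplx_eq_iff: "cplx A = cplx B \<longleftrightarrow> A = B"
  by (auto simp: vec_eq_iff)

lemma cplx_in_unitary_group: "cplx A \<in> unitary_group \<longleftrightarrow> orthogonal_matrix A"
  by (auto simp: unitary_group_def ctranspose_cplx orthogonal_matrix
      simp flip: cplx_mult cplx_one) (simp_all only: cplx_eq_iff)

text \<open>This is the matrix \<open>P\<close> of the introduction: multiplying a frame \<open>(w, w1, w2)\<close> on the right by it
  gives the frame \<open>(v, v1, v2)\<close> in the definition of \<open>\<Phi>\<close>.\<close>

definition frame_change :: cmat where
  "frame_change = vector [vector [1, 0, 0],
     vector [0, 1 / of_real (sqrt 2), \<i> / of_real (sqrt 2)],
     vector [0, - (1 / of_real (sqrt 2)), \<i> / of_real (sqrt 2)]]"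

lemma frame_change_unitary: "frame_change \<in> unitary_group"
  by (simp add: unitary_group_def mat3_eq_iff matrix_mult_nth3 frame_change_def mat_def
      flip: of_real_mult)

lemma det_frame_change: "det frame_change = \<i>"
  by (simp add: det_3 frame_change_def flip: of_real_mult)

lemma N2_frame_change: "n \<in> N2 \<Longrightarrow> n ** frame_change \<in> SU3"
  and SU3_frame_change: "g \<in> SU3 \<Longrightarrow> g ** ctranspose frame_change \<in> N2"
  by (auto simp: N2_def SU3_def unitary_mult unitary_ctranspose frame_change_unitary
      det_mul det_ctranspose det_frame_change)

section \<open>Isotropy groups and fibres of the orbit maps\<close>

definition K2_matrix :: "complex \<Rightarrow> cmat" where
  "K2_matrix a = vector [vector [1, 0, 0], vector [0, a, 0], vector [0, 0, cnj a]]"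

text \<open>The last two columns of \<open>P\<close> form a unitary basis of the plane of \<open>e2\<close> and \<open>e3\<close> in which
  \<open>diag(a, cnj a)\<close> has real entries, as the real rotation by the argument of \<open>a\<close> when \<open>\<bar>a\<bar> = 1\<close>.\<close>

lemma conj_K2_matrix:
  "ctranspose frame_change ** K2_matrix a ** frame_change =
    cplx (vector [vector [1, 0, 0], vector [0, Re a, - Im a], vector [0, Im a, Re a]])"
proof -
  have s: "complex_of_real (sqrt 2) * complex_of_real (sqrt 2) = 2"
    by (simp flip: of_real_mult)
  have "cnj a = of_real (Re a) - \<i> * of_real (Im a)" "a = of_real (Re a) + \<i> * of_real (Im a)"
    by (auto simp: complex_eq_iff)
  then obtain x y where xy: "cnj a = of_real x - \<i> * of_real y" "a = of_real x + \<i> * of_real y"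
      "Re a = x" "Im a = y"
    by blast
  show ?thesis
    unfolding K2_matrix_def xy
    by (simp add: mat3_eq_iff matrix_mult_nth3 frame_change_def field_simps s)
qed

lemma K2_matrix_SU3: "norm a = 1 \<Longrightarrow> K2_matrix a \<in> SU3"
  using complex_norm_square[of a]
  by (simp add: SU3_def unitary_group_def K2_matrix_def mat3_eq_iff matrix_mult_nth3 mat_def det_3
      mult.commute)

text \<open>The isotropy group of the standard flag: the hypotheses say that \<open>k\<close> fixes \<open>e1\<close> and preserves the
  complex span of \<open>e1\<close> and \<open>e2\<close>.  Orthogonality of the columns then forces \<open>k\<close> to be diagonal,
  and the determinant leaves one unit complex parameter.\<close>

lemma SU3_fixing_e1_eq_K2_matrix:
  assumes k: "k \<in> SU3" and col1: "k$1$1 = 1" "k$2$1 = 0" "k$3$1 = 0" and k32: "k$3$2 = 0"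
  obtains a where "norm a = 1" "k = K2_matrix a"
proof -
  have un: "(ctranspose k ** k)$i$j = mat 1 $ i $ j" for i j
    using k by (simp add: SU3_def unitary_group_def)
  have zero12: "k$1$2 = 0" and zero13: "k$1$3 = 0"
    using un[of 1 2] un[of 1 3] by (simp_all add: matrix_mult_nth3 col1 mat_def)
  have a: "k$2$2 * cnj (k$2$2) = 1"
    using un[of 2 2] by (simp add: matrix_mult_nth3 zero12 k32 mat_def mult.commute)
  then have "norm (k$2$2) = 1"
    using complex_norm_square[of "k$2$2"] by (simp add: abs_square_eq_1 flip: of_real_power)
  have zero23: "k$2$3 = 0"
    using un[of 2 3] a by (auto simp: matrix_mult_nth3 zero12 k32 mat_def)
  have "cnj (k$2$2) * (k$2$2 * k$3$3) = cnj (k$2$2)"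
    using k by (simp add: SU3_def det_3 col1 k32 zero12 zero13 zero23)
  then have "k$3$3 = cnj (k$2$2)"
    using a by (simp add: mult.assoc[symmetric] mult.commute)
  then have "k = K2_matrix (k$2$2)"
    by (simp add: mat3_eq_iff K2_matrix_def col1 k32 zero12 zero13 zero23)
  with \<open>norm (k$2$2) = 1\<close> show thesis
    by (rule that)
qed

lemma matrix_e1: "((g :: cmat) *v e1)$i = g$i$1"
  and matrix_e2: "((g :: cmat) *v e2)$i = g$i$2"
  by (auto simp: matrix_vector_nth3 e1_def e2_def axis_def)

text \<open>The isotropy groups of the two flag manifolds are conjugate by \<open>P\<close>, which is why \<open>\<Phi>\<close> exists and is
  injective.\<close>

lemma K1_eq: "K1 = {ctranspose frame_change ** K2_matrix a ** frame_change | a. norm a = 1}"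
proof (intro equalityI subsetI)
  fix k assume "k \<in> K1"
  then obtain A where k: "k \<in> SU3" "k = cplx A" "k *v e1 = e1"
    by (auto simp: K1_def)
  have col1: "A$1$1 = 1" "A$2$1 = 0" "A$3$1 = 0"
    using k(3) matrix_e1[of k 1] matrix_e1[of k 2] matrix_e1[of k 3] unfolding k(2)
    by (simp_all add: e1_def axis_def)
  have orth: "orthogonal_matrix A"
    using k by (simp add: SU3_unitary cplx_in_unitary_group[symmetric])
  have col: "(transpose A ** A)$i$j = mat 1 $ i $ j" for i j
    using orth by (simp add: orthogonal_matrix_def)
  have zero: "A$1$2 = 0" "A$1$3 = 0"
    using col[of 1 2] col[of 1 3] by (simp_all add: matrix_mult_nth3 col1 mat_def transpose_def)
  have "det A = 1"
    using k(1) by (simp add: SU3_def k(2) det_cplx)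
  then have "A$2$2 * A$3$3 - A$2$3 * A$3$2 = 1"
    by (simp add: det_3 col1 zero)
  moreover have sq: "(A$2$2)^2 + (A$3$2)^2 = 1" "(A$2$3)^2 + (A$3$3)^2 = 1"
    using col[of 2 2] col[of 3 3]
    by (simp_all add: matrix_mult_nth3 zero mat_def transpose_def power2_eq_square)
  \<comment> \<open>An orthogonal 2 by 2 block of determinant 1 is a rotation: the squared norms of its
    columns add up to 2, which is twice the determinant.\<close>
  ultimately have "(A$2$2 - A$3$3)^2 + (A$2$3 + A$3$2)^2 = 0"
    by (simp add: power2_eq_square algebra_simps)
  then have "A$3$3 = A$2$2" "A$2$3 = - A$3$2"
    unfolding sum_power2_eq_zero_iff by simp_all
  then have "k = ctranspose frame_change ** K2_matrix (Complex (A$2$2) (A$3$2)) ** frame_change"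
    unfolding conj_K2_matrix k(2) cplx_eq_iff by (simp add: mat3_eq_iff col1 zero)
  moreover have "norm (Complex (A$2$2) (A$3$2)) = 1"
    using sq by (simp add: complex_norm)
  ultimately show "k \<in> {ctranspose frame_change ** K2_matrix a ** frame_change | a. norm a = 1}"
    by blast
next
  fix k assume "k \<in> {ctranspose frame_change ** K2_matrix a ** frame_change | a. norm a = 1}"
  then obtain a where a: "norm a = 1" "k = ctranspose frame_change ** K2_matrix a ** frame_change"
    by blast
  have "det k = 1"
    unfolding a(2) using K2_matrix_SU3[OF a(1)]
    by (simp add: det_mul det_ctranspose det_frame_change SU3_def)
  then have "k \<in> SU3"
    using a K2_matrix_SU3[OF a(1)]
    by (simp add: SU3_def unitary_mult unitary_ctranspose frame_change_unitary)
  moreover have "k *v e1 = e1"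
    unfolding a(2) conj_K2_matrix
    by (simp add: vec_eq_iff forall_3 matrix_e1 e1_def axis_def matrix_vector_nth3)
  ultimately show "k \<in> K1"
    using a(2) conj_K2_matrix by (auto simp: K1_def)
qed

lemma oplane_eq_image: "oplane B = (**) B ` base_plane"
  by (auto simp: oplane_def base_plane_def)

text \<open>The real matrices with positive determinant form a group, so absorbing one of them only permutes the positively
  oriented bases.\<close>

lemma oplane_mult_real:
  assumes "det A > 0"
  shows "oplane (B ** cplx A) = oplane B"
proof (intro equalityI subsetI)
  fix X assume "X \<in> oplane (B ** cplx A)"
  then obtain A' where "X = B ** cplx A ** cplx A'" "det A' > 0"
    by (auto simp: oplane_def)
  then have "X = B ** cplx (A ** A')" "det (A ** A') > 0"
    using assms by (simp_all add: cplx_mult matrix_mul_assoc det_mul)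
  then show "X \<in> oplane B"
    unfolding oplane_def by blast
next
  fix X assume "X \<in> oplane B"
  then obtain A' where X: "X = B ** cplx A'" "det A' > 0"
    by (auto simp: oplane_def)
  obtain I where I: "A ** I = mat 1"
    using assms by (metis invertible_def invertible_det_nz less_irrefl)
  then have "det A * det I = 1"
    by (metis det_I det_mul)
  then have "det I > 0"
    using assms by (metis zero_less_mult_pos zero_less_one)
  then have "X = B ** cplx A ** cplx (I ** A')" "det (I ** A') > 0"
    using X I by (simp_all add: det_mul cplx_mult[symmetric] matrix_mul_assoc[symmetric])
      (simp add: matrix_mul_assoc)
  then show "X \<in> oplane (B ** cplx A)"
    unfolding oplane_def by blast
qed

text \<open>Two frames of the same oriented plane differ by a real matrix, since the standard frame is a positively
  oriented basis of the base plane.\<close>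

lemma pi1_eq_iff:
  assumes g: "g \<in> SU3" and h: "h \<in> SU3"
  shows "pi1 g = pi1 h \<longleftrightarrow> ctranspose h ** g \<in> K1"
proof
  assume eq: "pi1 g = pi1 h"
  have "mat 1 \<in> base_plane"
    unfolding base_plane_def oplane_def by (auto intro!: exI[of _ "mat 1"])
  then have "g \<in> (**) h ` base_plane"
    using eq imageI[of "mat 1" base_plane "(**) g"] by (simp add: pi1_def)
  then obtain A where "g = h ** cplx A"
    by (auto simp: base_plane_def oplane_def)
  then have "ctranspose h ** g = cplx A"
    using unitary_cancel[OF SU3_unitary[OF h]] by simp
  moreover have "(ctranspose h ** g) *v e1 = e1"
  proof -
    have "g *v e1 = h *v e1"
      using eq by (simp add: pi1_def)
    then show ?thesis
      by (simp add: matrix_vector_mul_assoc[symmetric])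
         (simp add: matrix_vector_mul_assoc unitary_left SU3_unitary h)
  qed
  ultimately show "ctranspose h ** g \<in> K1"
    using SU3_mult[OF SU3_ctranspose[OF h] g] by (auto simp: K1_def)
next
  assume k: "ctranspose h ** g \<in> K1"
  then obtain A where A: "ctranspose h ** g = cplx A" "det (cplx A) = 1"
    by (auto simp: K1_def SU3_def)
  have g_eq: "g = h ** cplx A"
    using A unitary_cancel[OF SU3_unitary[OF h]] by metis
  have "det A > 0"
    using A(2) by (simp add: det_cplx)
  then have "oplane g = oplane h"
    by (simp add: g_eq oplane_mult_real)
  moreover have "cplx A *v e1 = e1"
    using k unfolding A by (simp add: K1_def)
  then have "g *v e1 = h *v e1"
    by (simp add: g_eq matrix_vector_mul_assoc[symmetric])
  ultimately show "pi1 g = pi1 h"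
    by (simp add: pi1_def oplane_eq_image[symmetric])
qed

lemma span_pair: "vec.span {a, b} = {x *s a + y *s b | x y. True}"
  for a b :: cvec
  unfolding vec.span_insert vec.span_singleton
  by (auto simp: algebra_simps)

lemma span_pair_scale:
  fixes a b :: cvec
  assumes "c \<noteq> 0"
  shows "vec.span {a, c *s b} = vec.span {a, b}"
proof -
  have "x *s a + y *s b = x *s a + (y / c) *s (c *s b)" for x y
    using assms by (simp add: vector_smult_assoc)
  moreover have "x *s a + y *s (c *s b) = x *s a + (y * c) *s b" for x y
    by (simp add: vector_smult_assoc)
  ultimately show ?thesis
    unfolding span_pair by blast
qed

lemma pi2_eq_iff:
  assumes n: "n \<in> N2" and m: "m \<in> N2"
  shows "pi2 n = pi2 m \<longleftrightarrow> (\<exists>a. norm a = 1 \<and> ctranspose m ** n = K2_matrix a)"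
proof
  define k where "k = ctranspose m ** n"
  have m_un: "m \<in> unitary_group"
    by (rule N2_unitary[OF m])
  assume eq: "pi2 n = pi2 m"
  have k_SU3: "k \<in> SU3"
    unfolding k_def by (rule N2_quotient[OF m n])
  have "n *v e1 = m *v e1"
    using eq by (simp add: pi2_def)
  then have "k *v e1 = e1"
    by (simp add: k_def matrix_vector_mul_assoc[symmetric])
       (simp add: matrix_vector_mul_assoc unitary_left m_un)
  then have col1: "k$1$1 = 1" "k$2$1 = 0" "k$3$1 = 0"
    using matrix_e1[of k 1] matrix_e1[of k 2] matrix_e1[of k 3] by (simp_all add: e1_def axis_def)
  have "vec.span {n *v e1, n *v e2} = vec.span {m *v e1, m *v e2}"
    using eq unfolding pi2_def by (rule Pair_inject)
  moreover have "n *v e2 \<in> vec.span {n *v e1, n *v e2}"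
    by (rule vec.span_base) simp
  ultimately have "n *v e2 \<in> vec.span {m *v e1, m *v e2}"
    by (rule subst)
  then obtain x y where "n *v e2 = x *s (m *v e1) + y *s (m *v e2)"
    unfolding span_pair by blast
  then have "n *v e2 = m *v (x *s e1 + y *s e2)"
    by (simp add: matrix_vector_right_distrib vector_scalar_commute)
  then have "k *v e2 = x *s e1 + y *s e2"
    by (simp add: k_def matrix_vector_mul_assoc[symmetric])
       (simp add: matrix_vector_mul_assoc unitary_left m_un)
  then have "k$3$2 = 0"
    using matrix_e2[of k 3] by (simp add: e1_def e2_def axis_def)
  then show "\<exists>a. norm a = 1 \<and> ctranspose m ** n = K2_matrix a"
    using SU3_fixing_e1_eq_K2_matrix[OF k_SU3 col1] unfolding k_def by metis
next
  assume "\<exists>a. norm a = 1 \<and> ctranspose m ** n = K2_matrix a"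
  then obtain a where a: "norm a = 1" "ctranspose m ** n = K2_matrix a"
    by blast
  then have n_eq: "n = m ** K2_matrix a"
    using unitary_cancel[OF N2_unitary[OF m]] by metis
  have "K2_matrix a *v e1 = e1" "K2_matrix a *v e2 = a *s e2"
    by (simp_all add: vec_eq_iff forall_3 matrix_e1 matrix_e2)
       (simp_all add: K2_matrix_def e1_def e2_def axis_def)
  then have ne: "n *v e1 = m *v e1" "n *v e2 = a *s (m *v e2)"
    by (simp_all add: n_eq matrix_vector_mul_assoc[symmetric] vector_scalar_commute)
  have "a \<noteq> 0"
    using a by auto
  then have "vec.span {m *v e1, a *s (m *v e2)} = vec.span {m *v e1, m *v e2}"
    by (rule span_pair_scale)
  then show "pi2 n = pi2 m"
    by (simp add: pi2_def ne)
qed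

text \<open>Combines the two descriptions of the fibres with \<open>K1_eq\<close>: right translation by \<open>P\<close> carries
  cosets of \<open>K2\<close> to cosets of \<open>K1\<close>, and distinct cosets to distinct ones.\<close>

lemma pi1_frame_change_eq_iff:
  assumes n: "n \<in> N2" and m: "m \<in> N2"
  shows "pi1 (n ** frame_change) = pi1 (m ** frame_change) \<longleftrightarrow> pi2 n = pi2 m"
proof -
  let ?P = frame_change
  have "ctranspose (m ** ?P) ** (n ** ?P) = ctranspose ?P ** (ctranspose m ** n) ** ?P"
    by (simp add: ctranspose_mult matrix_mul_assoc)
  moreover have "ctranspose ?P ** A ** ?P = ctranspose ?P ** B ** ?P \<longleftrightarrow> A = B" for A B
    by (metis frame_change_unitary unitary_cancel)
  ultimately show ?thesis
    by (auto simp: pi1_eq_iff pi2_eq_iff n m N2_frame_change K1_eq)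
qed

section \<open>Adapted frames and the map \<open>\<Phi>\<close>\<close>

text \<open>The Hermitian inner product, conjugate linear in the first argument.\<close>

definition herm :: "cvec \<Rightarrow> cvec \<Rightarrow> complex" where
  "herm u v = cnj (u$1) * v$1 + cnj (u$2) * v$2 + cnj (u$3) * v$3"

lemma cnj_herm: "cnj (herm u v) = herm v u"
  by (simp add: herm_def mult.commute)

lemma herm_self: "herm u u = of_real ((norm u)\<^sup>2)"
  by (simp add: herm_def norm_vec_def L2_set_def sum_3 complex_norm_square[symmetric] mult.commute
      del: of_real_power)

lemma Re_herm: "Re (herm u v) = u \<bullet> v"
  by (simp add: herm_def inner_vec_def sum_3 inner_complex_def)

lemma norm_eq_1_iff_herm: "norm u = 1 \<longleftrightarrow> herm u u = 1"
  by (simp add: herm_self abs_square_eq_1 del: of_real_power)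

lemma cols3_nth [simp]:
  "cols3 a b c $ i $ 1 = a $ i" "cols3 a b c $ i $ 2 = b $ i" "cols3 a b c $ i $ 3 = c $ i"
  by (simp_all add: cols3_def transpose_def)

lemma cols3_eta: "cols3 (g *v e1) (g *v e2) (g *v axis 3 1) = g"
  by (simp add: vec_eq_iff forall_3 matrix_e1 matrix_e2) (simp add: matrix_vector_nth3 axis_def)

lemma cols3_e1: "cols3 a b c *v e1 = a" and cols3_e2: "cols3 a b c *v e2 = b"
  by (simp_all add: vec_eq_iff matrix_e1 matrix_e2)

lemma cols3_unitary_iff:
  "cols3 a b c \<in> unitary_group \<longleftrightarrow>
    herm a a = 1 \<and> herm b b = 1 \<and> herm c c = 1 \<and> herm a b = 0 \<and> herm a c = 0 \<and> herm b c = 0"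
proof -
  have "herm v u = 0 \<longleftrightarrow> herm u v = 0" for u v
    by (metis cnj_herm complex_cnj_zero_iff)
  then show ?thesis
    by (simp add: unitary_group_def mat3_eq_iff matrix_mult_nth3 mat_def herm_def) auto
qed

text \<open>The missing vector is a multiple of the conjugate of the cross product of the two given
  vectors.  The factor \<open>-\<i>\<close> in it produces the determinant required in \<open>N2\<close>.\<close>

lemma unitary_frame_extension:
  assumes w: "herm w w = 1" and w1: "herm w1 w1 = 1" and orth: "herm w w1 = 0"
  obtains w2 where "cols3 w w1 w2 \<in> N2"
proof
  define c where "c = (vector [w$2 * w1$3 - w$3 * w1$2, w$3 * w1$1 - w$1 * w1$3,
    w$1 * w1$2 - w$2 * w1$1] :: cvec)"
  define w2 where "w2 = (\<chi> i. - \<i> * cnj (c $ i))"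
  have c: "c$1 = w$2 * w1$3 - w$3 * w1$2" "c$2 = w$3 * w1$1 - w$1 * w1$3"
      "c$3 = w$1 * w1$2 - w$2 * w1$1"
    by (simp_all add: c_def)
  have lagrange: "herm c c = herm w w * herm w1 w1 - herm w w1 * herm w1 w"
    unfolding herm_def c by (simp add: algebra_simps)
  then have cc: "herm c c = 1"
    by (simp add: w w1 orth)
  have "herm w2 w2 = herm c c"
    by (simp add: herm_def w2_def algebra_simps)
  moreover have "herm w w2 = 0" "herm w1 w2 = 0"
    by (simp_all add: herm_def w2_def c algebra_simps)
  ultimately have un: "cols3 w w1 w2 \<in> unitary_group"
    by (simp add: cols3_unitary_iff w w1 orth cc)
  have "det (cols3 w w1 w2) = - \<i> * herm c c"
    by (simp add: det_3 herm_def w2_def c algebra_simps)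
  then show "cols3 w w1 w2 \<in> N2"
    using un by (simp add: N2_def cc)
qed

lemma pi2_cols3: "pi2 (cols3 w w1 w2) = (w, vec.span {w, w1})"
  by (simp add: pi2_def cols3_e1 cols3_e2)

lemma wedge3_frame_change:
  "(w, wedge3 w ((1 / of_real (sqrt 2)) *s (w1 - w2)) ((\<i> / of_real (sqrt 2)) *s (w1 + w2)))
    = pi1 (cols3 w w1 w2 ** frame_change)"
proof -
  have "cols3 w ((1 / of_real (sqrt 2)) *s (w1 - w2)) ((\<i> / of_real (sqrt 2)) *s (w1 + w2))
      = cols3 w w1 w2 ** frame_change"
    by (simp add: mat3_eq_iff matrix_mult_nth3 frame_change_def algebra_simps)
  moreover have "(cols3 w w1 w2 ** frame_change) *v e1 = w"
    by (simp add: vec_eq_iff forall_3 matrix_e1 matrix_mult_nth3 frame_change_def)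
  ultimately show ?thesis
    by (simp add: wedge3_def pi1_def oplane_eq_image)
qed

text \<open>On frames \<open>\<Phi>\<close> is right translation by \<open>P\<close>.  Any two adapted bases with the prescribed determinant are
  frames of the same flag, so by \<open>pi1_frame_change_eq_iff\<close> the value is independent of the choice.\<close>

lemma Phi_pi2:
  assumes n: "n \<in> N2"
  shows "Phi (pi2 n) = pi1 (n ** frame_change)"
proof -
  define w where "w = n *v e1"
  define W where "W = vec.span {n *v e1, n *v e2}"
  have pi2_n: "pi2 n = (w, W)"
    by (simp add: pi2_def w_def W_def)
  have "Phi (w, W) = pi1 (n ** frame_change)"
    unfolding Phi_def prod.case
  proof (rule the_equality)
    show "\<exists>w1 w2. cols3 w w1 w2 \<in> N2 \<and> W = vec.span {w, w1} \<and> pi1 (n ** frame_change) =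
        (w, wedge3 w ((1 / of_real (sqrt 2)) *s (w1 - w2)) ((\<i> / of_real (sqrt 2)) *s (w1 + w2)))"
      unfolding wedge3_frame_change
      by (rule exI[of _ "n *v e2"], rule exI[of _ "n *v axis 3 1"])
         (simp add: w_def W_def cols3_eta n)
  next
    fix q
    assume "\<exists>w1 w2. cols3 w w1 w2 \<in> N2 \<and> W = vec.span {w, w1} \<and> q =
        (w, wedge3 w ((1 / of_real (sqrt 2)) *s (w1 - w2)) ((\<i> / of_real (sqrt 2)) *s (w1 + w2)))"
    then obtain w1 w2 where m: "cols3 w w1 w2 \<in> N2" "W = vec.span {w, w1}"
        "q = pi1 (cols3 w w1 w2 ** frame_change)"
      unfolding wedge3_frame_change by blast
    have "pi2 (cols3 w w1 w2) = pi2 n"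
      by (simp add: pi2_cols3 pi2_n m(2))
    then show "q = pi1 (n ** frame_change)"
      by (simp add: m(3) pi1_frame_change_eq_iff[OF m(1) n])
  qed
  then show ?thesis
    by (simp add: pi2_n)
qed

lemma herm_linear: "herm u (x *s v + y *s w) = x * herm u v + y * herm u w"
  by (simp add: herm_def algebra_simps)

lemma pi2_in_FL2:
  assumes n: "n \<in> N2"
  shows "pi2 n \<in> FL2"
proof -
  define w where "w = n *v e1"
  define w1 where "w1 = n *v e2"
  have "cols3 w w1 (n *v axis 3 1) \<in> unitary_group"
    using N2_unitary[OF n] by (simp add: w_def w1_def cols3_eta)
  then have herm: "herm w w = 1" "herm w1 w1 = 1" "herm w w1 = 0"
    by (simp_all add: cols3_unitary_iff)
  have norm: "norm w = 1"
    using herm(1) by (simp add: norm_eq_1_iff_herm)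
  have w1_notin: "w1 \<notin> vec.span {w}"
  proof
    assume "w1 \<in> vec.span {w}"
    then obtain x where "w1 = x *s w"
      by (auto simp: vec.span_singleton)
    then have "herm w w1 = x"
      using herm_linear[of w x w 0 0] by (simp add: herm)
    then show False
      using \<open>w1 = x *s w\<close> herm by (simp add: herm_def)
  qed
  moreover have "w \<noteq> 0"
    using norm by auto
  ultimately have "vec.independent {w1, w}" "w1 \<noteq> w"
    using vec.span_base[of w "{w}"] by (auto simp: vec.independent_insert)
  then have "vec.dim (vec.span {w, w1}) = 2"
    using vec.dim_eq_card_independent[of "{w1, w}"] by (simp add: vec.dim_span insert_commute)
  then show ?thesis
    using norm by (simp add: FL2_def pi2_def flip: w_def w1_def)
      (simp add: vec.span_base)
qed

text \<open>Gram-Schmidt inside the complex plane, followed by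
  \<open>unitary_frame_extension\<close>.\<close>

lemma FL2_obtain_frame:
  assumes "p \<in> FL2"
  obtains n where "n \<in> N2" "pi2 n = p"
proof -
  obtain w W where p: "p = (w, W)" "norm w = 1" "vec.subspace W" "vec.dim W = 2" "w \<in> W"
    using assms by (auto simp: FL2_def)
  have w: "herm w w = 1"
    using p by (simp add: norm_eq_1_iff_herm)
  have "\<not> W \<subseteq> vec.span {w}"
  proof
    assume "W \<subseteq> vec.span {w}"
    then have "vec.dim W \<le> card {w}"
      by (intro vec.dim_le_card) auto
    then show False
      by (simp add: p)
  qed
  then obtain u where u: "u \<in> W" "u \<notin> vec.span {w}"
    by blast
  define u' where "u' = u - herm w u *s w"
  have "u' \<noteq> 0"
    using u(2) by (auto simp: u'_def vec.span_singleton)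
  define w1 where "w1 = of_real (1 / norm u') *s u'"
  have "herm w u' = 0"
    using herm_linear[of w 1 u "- herm w u" w] w by (simp add: u'_def)
  then have orth: "herm w w1 = 0"
    using herm_linear[of w _ u' 0 0] by (simp add: w1_def)
  have "herm w1 w1 = of_real ((1 / norm u')\<^sup>2) * herm u' u'"
    by (simp add: w1_def herm_def algebra_simps power2_eq_square)
  then have w1: "herm w1 w1 = 1"
    using \<open>u' \<noteq> 0\<close> by (simp add: herm_self power_divide flip: of_real_mult of_real_power)
  obtain w2 where n: "cols3 w w1 w2 \<in> N2"
    using unitary_frame_extension[OF w w1 orth] .
  have "w1 \<in> W"
    unfolding w1_def u'_def using p u
    by (intro vec.subspace_scale vec.subspace_diff) auto
  then have sub: "vec.span {w, w1} \<subseteq> W"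
    using p by (intro vec.span_minimal) auto
  moreover have "vec.dim (vec.span {w, w1}) = 2"
    using pi2_in_FL2[OF n] by (simp add: pi2_cols3 FL2_def)
  ultimately have "vec.span {w, w1} = W"
    using p by (intro vec.subspace_dim_equal) auto
  then show thesis
    using that[OF n] by (simp add: pi2_cols3 p)
qed

lemma underlying_plane_real_combination:
  assumes v: "v \<in> underlying_plane ((**) g ` base_plane)"
  obtains r :: "real^3" where "v = g *v (\<chi> i. of_real (r$i))"
proof -
  let ?c = "\<lambda>r::real^3. \<chi> i. complex_of_real (r$i)"
  obtain A where A: "v \<in> span (columns (g ** cplx A))"
    using v by (auto simp: underlying_plane_def base_plane_def oplane_def)
  have "span (columns (g ** cplx A)) \<subseteq> range (\<lambda>r. g *v ?c r)"
  proof (rule span_minimal)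
    show "columns (g ** cplx A) \<subseteq> range (\<lambda>r. g *v ?c r)"
    proof
      fix u assume "u \<in> columns (g ** cplx A)"
      then obtain j where "u = column j (g ** cplx A)"
        by (auto simp: columns_def)
      then have "u = g *v ?c (column j A)"
        by (simp add: column_def vec_eq_iff matrix_vector_nth3 matrix_mult_nth3)
      then show "u \<in> range (\<lambda>r. g *v ?c r)"
        by blast
    qed
    have "linear (\<lambda>r. g *v ?c r)"
      by (intro linearI)
         (simp_all add: vec_eq_iff matrix_vector_nth3 algebra_simps scaleR_conv_of_real[where 'a=complex])
    then show "subspace (range (\<lambda>r. g *v ?c r))"
      by (intro linear_subspace_image subspace_UNIV)
  qed
  then show thesis
    using A that by blast
qed

text \<open>A unit vector in the real span of the columns of \<open>g \<in> SU3\<close> is \<open>g r\<close> with \<open>r\<close> a real unit vector.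
  Composing \<open>g\<close> with a rotation that takes \<open>e1\<close> to \<open>r\<close> changes the frame, but not
  the oriented plane.\<close>

lemma FL1_obtain_frame:
  assumes "q \<in> FL1"
  obtains g where "g \<in> SU3" "pi1 g = q"
proof -
  obtain v g where q: "q = (v, (**) g ` base_plane)" "norm v = 1" "g \<in> SU3"
      "v \<in> underlying_plane ((**) g ` base_plane)"
    using assms by (auto simp: FL1_def SL_def)
  obtain r :: "real^3" where v: "v = g *v (\<chi> i. of_real (r$i))"
    using underlying_plane_real_combination[OF q(4)] .
  let ?r = "\<chi> i. complex_of_real (r$i)"
  have "herm v v = herm ?r ?r"
  proof -
    have "herm (g *v x) (g *v y) = herm x ((ctranspose g ** g) *v y)" for x y
      by (simp add: herm_def matrix_vector_nth3 matrix_mult_nth3 algebra_simps)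
    then show ?thesis
      using SU3_unitary[OF q(3)] by (simp add: v unitary_left)
  qed
  moreover have "norm ?r = norm r"
    by (simp add: norm_vec_def)
  ultimately have "norm r = 1"
    using q(2) norm_eq_1_iff_herm by (metis)
  then obtain f where f: "orthogonal_transformation f" "det (matrix f) = 1" "f (axis 1 1) = r"
    using rotation_exists_1[of "axis 1 1" r] by (auto simp: norm_axis_1)
  define A where "A = matrix f"
  have A: "orthogonal_matrix A" "det A = 1"
    using f by (auto simp: A_def orthogonal_transformation_matrix)
  have "A *v axis 1 1 = r"
    using f by (simp add: A_def orthogonal_transformation_def)
  then have r: "A$i$1 = r$i" for i
    by (auto simp: matrix_vector_nth3 axis_def)
  have A_SU3: "cplx A \<in> SU3"
    using A by (simp add: SU3_def cplx_in_unitary_group det_cplx)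
  show thesis
  proof
    show "g ** cplx A \<in> SU3"
      by (rule SU3_mult[OF q(3) A_SU3])
    have "oplane (g ** cplx A) = oplane g"
      by (rule oplane_mult_real) (simp add: A)
    moreover have "(g ** cplx A) *v e1 = v"
      by (simp add: v vec_eq_iff e1_def axis_def matrix_mult_nth3 r matrix_vector_nth3)
    ultimately show "pi1 (g ** cplx A) = q"
      by (simp add: pi1_def q oplane_eq_image)
  qed
qed

lemma pi1_in_FL1:
  assumes g: "g \<in> SU3"
  shows "pi1 g \<in> FL1"
proof -
  have "cols3 (g *v e1) (g *v e2) (g *v axis 3 1) \<in> unitary_group"
    using SU3_unitary[OF g] by (simp add: cols3_eta)
  then have "herm (g *v e1) (g *v e1) = 1"
    by (simp add: cols3_unitary_iff)
  then have norm: "norm (g *v e1) = 1"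
    by (simp add: norm_eq_1_iff_herm)
  have "g \<in> (**) g ` base_plane"
    unfolding base_plane_def oplane_def
    by (intro image_eqI[where x = "mat 1"]) (auto intro!: exI[of _ "mat 1"])
  moreover have "g *v e1 = column 1 g"
    by (simp add: vec_eq_iff matrix_e1 column_def)
  then have "g *v e1 \<in> span (columns g)"
    by (auto simp: columns_def intro: span_base)
  ultimately have "g *v e1 \<in> underlying_plane ((**) g ` base_plane)"
    unfolding underlying_plane_def by blast
  then show ?thesis
    using norm g by (auto simp: FL1_def pi1_def SL_def)
qed

lemma Phi_bij: "bij_betw Phi FL2 FL1"
proof (rule bij_betwI')
  fix p p' assume "p \<in> FL2" "p' \<in> FL2"
  then obtain n m where "n \<in> N2" "pi2 n = p" "m \<in> N2" "pi2 m = p'"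
    using FL2_obtain_frame by metis
  then show "Phi p = Phi p' \<longleftrightarrow> p = p'"
    using Phi_pi2 pi1_frame_change_eq_iff by metis
next
  fix p assume "p \<in> FL2"
  then show "Phi p \<in> FL1"
    using FL2_obtain_frame Phi_pi2 N2_frame_change pi1_in_FL1 by metis
next
  fix q assume "q \<in> FL1"
  then obtain g where g: "g \<in> SU3" "pi1 g = q"
    using FL1_obtain_frame by metis
  have "Phi (pi2 (g ** ctranspose frame_change)) = q"
    using g by (simp add: Phi_pi2 SU3_frame_change unitary_cancel frame_change_unitary)
  then show "\<exists>p\<in>FL2. q = Phi p"
    using g SU3_frame_change pi2_in_FL2 by metis
qed

section \<open>The order six automorphism\<close>

definition rot :: "real \<Rightarrow> cmat" where
  "rot t = cplx (vector [vector [1, 0, 0], vector [0, cos t, sin t], vector [0, - sin t, cos t]])"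

lemma rot_add: "rot (s + t) = rot s ** rot t"
  by (simp add: rot_def mat3_eq_iff matrix_mult_nth3 cos_add sin_add algebra_simps)

lemma rot_zero: "rot 0 = mat 1"
  by (simp add: rot_def mat3_eq_iff mat_def)

lemma ctranspose_rot: "ctranspose (rot t) = rot (- t)"
  by (simp add: rot_def mat3_eq_iff)

lemma rot_SU3: "rot t \<in> SU3"
proof -
  have "cos t * cos t + sin t * sin t = 1"
    using sin_cos_squared_add2[of t] by (simp add: power2_eq_square)
  then have "det (rot t) = 1"
    by (simp add: rot_def det_cplx) (simp add: det_3)
  then show ?thesis
    by (simp add: SU3_def unitary_group_def ctranspose_rot rot_zero flip: rot_add)
qed

lemma matrix_inv_unitary:
  assumes g: "g \<in> unitary_group"
  shows "matrix_inv g = ctranspose g"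
  unfolding matrix_inv_def
proof (rule some_equality)
  show "g ** ctranspose g = mat 1 \<and> ctranspose g ** g = mat 1"
    by (simp add: g unitary_left unitary_right)
  show "h = ctranspose g" if "g ** h = mat 1 \<and> h ** g = mat 1" for h
    using that unitary_cancel(1)[OF g, of h] by simp
qed

lemma Rmat_eq_rot: "Rmat = rot (pi / 3)"
  by (simp add: Rmat_def rot_def mat3_eq_iff)

abbreviation mcnj :: "cmat \<Rightarrow> cmat" where
  "mcnj \<equiv> map_matrix cnj"

lemma mcnj_mult: "mcnj (A ** B) = mcnj A ** mcnj B"
  by (simp add: vec_eq_iff matrix_matrix_mult_def)

lemma mcnj_rot: "mcnj (rot t) = rot t"
  by (simp add: rot_def mat3_eq_iff)

lemma det_mcnj: "det (mcnj g) = cnj (det g)"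
  by (simp add: det_3)

lemma mcnj_SU3: "g \<in> SU3 \<Longrightarrow> mcnj g \<in> SU3"
proof -
  assume g: "g \<in> SU3"
  have "ctranspose (mcnj g) ** mcnj g = mcnj (ctranspose g ** g)"
    by (simp add: vec_eq_iff matrix_matrix_mult_def)
  also have "\<dots> = mat 1"
    using unitary_left[OF SU3_unitary[OF g]] by (simp add: vec_eq_iff mat_def)
  finally show "mcnj g \<in> SU3"
    using g by (simp add: SU3_def unitary_group_def det_mcnj)
qed

text \<open>The inverse transpose of a unitary matrix is its complex conjugate.\<close>

lemma sigma_hat_SU3:
  assumes "g \<in> SU3"
  shows "sigma_hat g = rot (pi / 3) ** mcnj g ** rot (- (pi / 3))"
proof -
  have "transpose (ctranspose g) = mcnj g"
    by (simp add: vec_eq_iff transpose_def)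
  then show ?thesis
    using assms by (simp add: sigma_hat_def Rmat_eq_rot matrix_inv_unitary SU3_unitary rot_SU3
        ctranspose_rot)
qed

lemma sigma_hat_in_SU3: "g \<in> SU3 \<Longrightarrow> sigma_hat g \<in> SU3"
  by (simp add: sigma_hat_SU3 SU3_mult rot_SU3 mcnj_SU3)

lemma sigma_hat_funpow_in_SU3: "g \<in> SU3 \<Longrightarrow> (sigma_hat ^^ j) g \<in> SU3"
  by (induction j) (auto simp: sigma_hat_in_SU3)

text \<open>Conjugation by real rotations commutes with complex conjugation, so in the iterates the angles add up and the complex
  conjugations cancel in pairs.\<close>

lemma sigma_hat_funpow:
  assumes g: "g \<in> SU3"
  shows "(sigma_hat ^^ j) g = rot (real j * (pi / 3)) ** (mcnj ^^ j) g ** rot (- (real j * (pi / 3)))"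
proof (induction j)
  case 0
  then show ?case
    by (simp add: rot_zero)
next
  case (Suc j)
  have "(sigma_hat ^^ Suc j) g = rot (pi / 3) ** mcnj ((sigma_hat ^^ j) g) ** rot (- (pi / 3))"
    using sigma_hat_SU3[OF sigma_hat_funpow_in_SU3[OF g]] by simp
  also have "\<dots> = (rot (pi / 3) ** rot (real j * (pi / 3))) ** (mcnj ^^ Suc j) g
      ** (rot (- (real j * (pi / 3))) ** rot (- (pi / 3)))"
    unfolding Suc.IH by (simp add: mcnj_mult mcnj_rot matrix_mul_assoc)
  also have "\<dots> = rot (real (Suc j) * (pi / 3)) ** (mcnj ^^ Suc j) g ** rot (- (real (Suc j) * (pi / 3)))"
  proof -
    have "pi / 3 + real j * (pi / 3) = real (Suc j) * (pi / 3)"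
        "- (real j * (pi / 3)) + - (pi / 3) = - (real (Suc j) * (pi / 3))"
      by (simp_all add: field_simps)
    then show ?thesis
      unfolding rot_add[symmetric] by (simp only:)
  qed
  finally show ?case .
qed

lemma sigma_hat_funpow6:
  assumes "g \<in> SU3"
  shows "(sigma_hat ^^ 6) g = g"
proof -
  have "rot (2 * pi) = mat 1" "rot (- (2 * pi)) = mat 1"
    by (simp_all add: rot_def mat3_eq_iff mat_def)
  moreover have "(mcnj ^^ 6) g = g"
    by (simp add: eval_nat_numeral vec_eq_iff)
  ultimately show ?thesis
    by (simp add: sigma_hat_funpow[OF assms])
qed

lemma sigma_hat_mult:
  assumes "a \<in> SU3" "b \<in> SU3"
  shows "sigma_hat (a ** b) = sigma_hat a ** sigma_hat b"
proof -
  have "X ** rot (- (pi / 3)) ** rot (pi / 3) = X" for X :: cmat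
    by (simp add: rot_zero flip: rot_add matrix_mul_assoc)
  then show ?thesis
    using assms by (simp add: sigma_hat_SU3 SU3_mult mcnj_mult matrix_mul_assoc)
qed

lemma sigma_hat_bij: "bij_betw sigma_hat SU3 SU3"
proof (rule bij_betw_byWitness)
  show "\<forall>a\<in>SU3. (sigma_hat ^^ 5) (sigma_hat a) = a" "\<forall>a\<in>SU3. sigma_hat ((sigma_hat ^^ 5) a) = a"
    using sigma_hat_funpow6 by (simp_all add: eval_nat_numeral)
  show "sigma_hat ` SU3 \<subseteq> SU3" "(sigma_hat ^^ 5) ` SU3 \<subseteq> SU3"
    using sigma_hat_in_SU3 sigma_hat_funpow_in_SU3 by auto
qed

text \<open>The cyclic permutation \<open>g\<close> of the basis is real and takes \<open>e1\<close> to \<open>e2\<close>.  Being fixed by the \<open>j\<close>-th power, it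
  would commute with the rotation by \<open>j \<cdot> 60\<close> degrees; as that rotation fixes \<open>e1\<close>, it would also fix \<open>e2\<close>.\<close>

lemma sigma_hat_funpow_nontrivial:
  assumes j: "0 < j" "j < 6"
  shows "\<exists>g\<in>SU3. (sigma_hat ^^ j) g \<noteq> g"
proof
  define g :: cmat where "g = vector [vector [0, 0, 1], vector [1, 0, 0], vector [0, 1, 0]]"
  show g: "g \<in> SU3"
    by (simp add: g_def SU3_def unitary_group_def mat3_eq_iff matrix_mult_nth3 mat_def det_3)
  define t where "t = real j * (pi / 3)"
  have real_g: "(mcnj ^^ j) g = g"
    by (induction j) (auto simp: g_def mat3_eq_iff)
  show "(sigma_hat ^^ j) g \<noteq> g"
  proof
    assume "(sigma_hat ^^ j) g = g"
    then have "rot t ** g ** rot (- t) = g"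
      by (simp add: sigma_hat_funpow[OF g] real_g t_def)
    then have "(rot t ** g ** rot (- t)) $ 2 $ 1 = g $ 2 $ 1"
      by simp
    then have "cos t = 1"
      by (simp add: rot_def g_def matrix_mult_nth3)
    then obtain n :: int where "t = of_int n * 2 * pi"
      by (auto simp: cos_one_2pi_int)
    then have "real j = 6 * of_int n"
      by (simp add: t_def)
    then have "int j = 6 * n"
      by linarith
    then show False
      using j by presburger
  qed
qed

lemma sigma_hat_fixed_commutes:
  assumes g: "g \<in> SU3" and fixed: "sigma_hat g = g"
  shows "rot (pi / 3) ** mcnj g = g ** rot (pi / 3)"
    and "rot (2 * pi / 3) ** g = g ** rot (2 * pi / 3)"
proof -
  have cancel: "X ** rot (- t) ** rot t = X" for X :: cmat and t
    by (simp add: rot_zero flip: rot_add matrix_mul_assoc)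
  show "rot (pi / 3) ** mcnj g = g ** rot (pi / 3)"
    using fixed cancel by (metis sigma_hat_SU3[OF g])
  have "(sigma_hat ^^ 2) g = g"
    by (simp add: eval_nat_numeral fixed)
  moreover have "(mcnj ^^ 2) g = g"
    by (simp add: eval_nat_numeral vec_eq_iff)
  ultimately have "rot (2 * pi / 3) ** g ** rot (- (2 * pi / 3)) = g"
    using sigma_hat_funpow[OF g, of 2] by simp
  then show "rot (2 * pi / 3) ** g = g ** rot (2 * pi / 3)"
    using cancel by metis
qed

lemma rotation_equations_zero:
  fixes x y :: complex and c s :: real
  assumes "c * x + s * y = 0" "- s * x + c * y = 0" and cs: "c\<^sup>2 + s\<^sup>2 \<noteq> 0"
  shows "x = 0 \<and> y = 0"
proof -
  have "of_real (c\<^sup>2 + s\<^sup>2) * x = c * (c * x + s * y) - s * (- s * x + c * y)"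
       "of_real (c\<^sup>2 + s\<^sup>2) * y = s * (c * x + s * y) + c * (- s * x + c * y)"
    by (simp_all add: power2_eq_square algebra_simps)
  then show ?thesis
    using assms by (metis diff_zero add_0 mult_zero_right mult_eq_0_iff of_real_eq_0_iff)
qed

text \<open>A fixed point of \<open>sigma_hat\<close> commutes with the rotation by 120 degrees, as it is fixed by the square of
  \<open>sigma_hat\<close>.  So it is block diagonal, and its 2 by 2 block is a complex combination of rotations.  Hence it
  commutes also with the rotation by 60 degrees, and being fixed by \<open>sigma_hat\<close> now says that it is real.  The
  determinant excludes the entry \<open>-1\<close> in the corner.\<close>

lemma sigma_hat_fixed_points: "{g \<in> SU3. sigma_hat g = g} = K1"
proof (intro equalityI subsetI)
  fix g assume "g \<in> {g \<in> SU3. sigma_hat g = g}"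
  then have g: "g \<in> SU3" "sigma_hat g = g"
    by auto
  define c s where "c = cos (2 * pi / 3)" and "s = sin (2 * pi / 3)"
  have "(rot (2 * pi / 3) ** g) $ i $ j = (g ** rot (2 * pi / 3)) $ i $ j" for i j
    by (simp add: sigma_hat_fixed_commutes[OF g])
  note comm = this[unfolded matrix_mult_nth3 rot_def, folded c_def s_def]
  have "s \<noteq> 0"
    using sin_gt_zero[of "2 * pi / 3"] by (simp add: s_def)
  have "g$1$2 = 0 \<and> g$1$3 = 0"
    by (rule rotation_equations_zero[of "c - 1" _ "-s"])
       (use comm[of 1 2] comm[of 1 3] \<open>s \<noteq> 0\<close> in \<open>simp_all add: algebra_simps sum_power2_eq_zero_iff\<close>)
  moreover have "g$2$1 = 0 \<and> g$3$1 = 0"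
    by (rule rotation_equations_zero[of "c - 1" _ "s"])
       (use comm[of 2 1] comm[of 3 1] \<open>s \<noteq> 0\<close> in \<open>simp_all add: algebra_simps sum_power2_eq_zero_iff\<close>)
  moreover have "g$2$3 = - (g$3$2)"
  proof -
    have "complex_of_real s * (g$2$3 + g$3$2) = 0"
      using comm[of 2 2] by (simp add: algebra_simps)
    then show ?thesis
      using \<open>s \<noteq> 0\<close> by (simp add: eq_neg_iff_add_eq_0)
  qed
  moreover have "g$3$3 = g$2$2"
    using comm[of 2 3] \<open>s \<noteq> 0\<close> by (simp add: algebra_simps)
  ultimately have entries: "g$1$2 = 0" "g$1$3 = 0" "g$2$1 = 0" "g$3$1 = 0" "g$2$3 = - (g$3$2)"
      "g$3$3 = g$2$2"
    by auto
  have "(rot (pi / 3) ** mcnj g) $ i $ j = (g ** rot (pi / 3)) $ i $ j" for i j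
    by (simp add: sigma_hat_fixed_commutes[OF g])
  note comm' = this[unfolded matrix_mult_nth3 rot_def]
  have "cnj (g$2$2) - g$2$2 = 0 \<and> cnj (g$3$2) - g$3$2 = 0"
    by (rule rotation_equations_zero[of "cos (pi / 3)" _ "sin (pi / 3)"])
       (use comm'[of 2 2] comm'[of 3 2] in \<open>simp_all add: entries algebra_simps\<close>)
  moreover have "cnj (g$1$1) = g$1$1"
    using comm'[of 1 1] by (simp add: entries)
  ultimately have real: "complex_of_real (Re (g$1$1)) = g$1$1" "complex_of_real (Re (g$2$2)) = g$2$2"
      "complex_of_real (Re (g$3$2)) = g$3$2"
    by (auto simp: complex_eq_iff)
  define A where "A = (\<chi> i j. Re (g$i$j))"
  have g_eq: "g = cplx A"
    by (simp add: mat3_eq_iff A_def real entries)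
  have "orthogonal_matrix A"
    using g by (simp add: g_eq SU3_unitary flip: cplx_in_unitary_group)
  then have "(transpose A ** A)$1$1 = 1"
    by (simp add: orthogonal_matrix_def mat_def)
  then have "(A$1$1)\<^sup>2 = 1"
    by (simp add: matrix_mult_nth3 transpose_def A_def entries power2_eq_square)
  moreover have "det A = 1"
    using g by (simp add: SU3_def g_eq det_cplx)
  then have "A$1$1 * ((A$2$2)\<^sup>2 + (A$3$2)\<^sup>2) = 1"
    by (simp add: det_3 A_def entries power2_eq_square algebra_simps)
  then have "A$1$1 > 0"
    by (metis zero_less_mult_pos2 zero_less_one sum_power2_ge_zero less_eq_real_def mult_zero_right zero_neq_one)
  ultimately have "A$1$1 = 1"
    by (simp add: power2_eq_1_iff)
  then have "g *v e1 = e1"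
    using real(1) unfolding vec_eq_iff forall_3 matrix_e1
    by (simp add: entries A_def e1_def axis_def)
  then show "g \<in> K1"
    using g g_eq by (auto simp: K1_def)
next
  fix k assume k: "k \<in> K1"
  then have "k \<in> SU3"
    by (simp add: K1_def)
  obtain a where a: "k = cplx (vector [vector [1, 0, 0], vector [0, Re a, - Im a], vector [0, Im a, Re a]])"
    using k unfolding K1_eq conj_K2_matrix by blast
  have "mcnj k = k"
    by (simp add: a mat3_eq_iff)
  moreover have "rot (pi / 3) ** k = k ** rot (pi / 3)"
    by (simp add: a rot_def mat3_eq_iff matrix_mult_nth3 algebra_simps)
  ultimately have "sigma_hat k = k"
    using \<open>k \<in> SU3\<close> by (simp add: sigma_hat_SU3 rot_zero flip: matrix_mul_assoc rot_add)
  then show "k \<in> {g \<in> SU3. sigma_hat g = g}"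
    using \<open>k \<in> SU3\<close> by simp
qed

lemma sigma_hat_6_symmetric: "k_symmetric 6 SU3 K1 sigma_hat"
  unfolding k_symmetric_def sigma_hat_fixed_points
  using sigma_hat_bij sigma_hat_mult sigma_hat_funpow6 sigma_hat_funpow_nontrivial
    connected_component_subset by blast

section \<open>One-parameter subgroups\<close>

text \<open>Powers for the matrix product; the operation \<open>^\<close> on this type multiplies entry by entry.\<close>

abbreviation mpow :: "cmat \<Rightarrow> nat \<Rightarrow> cmat" where
  "mpow X n \<equiv> ((**) X ^^ n) (mat 1)"

lemma mpow_bound:
  assumes "\<And>i j. norm (X$i$j) \<le> M"
  shows "norm (mpow X n $ i $ j) \<le> (3 * M) ^ n"
proof (induction n arbitrary: i j)
  case 0
  then show ?case
    by (simp add: mat_def)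
next
  case (Suc n)
  have "norm (X$i$k * mpow X n $ k $ j) \<le> M * (3 * M) ^ n" for k
    using Suc.IH assms norm_ge_zero order_trans
    unfolding norm_mult by (intro mult_mono) blast+
  then have "norm (mpow X (Suc n) $ i $ j) \<le> M * (3 * M) ^ n + M * (3 * M) ^ n + M * (3 * M) ^ n"
    unfolding funpow.simps comp_apply matrix_mult_nth3
    by (intro norm_triangle_le add_mono) auto
  then show ?case
    by (simp add: mult_ac)
qed

lemma mpow_series_summable: "summable (\<lambda>n. mpow X n $ i $ j / fact n * z ^ n)"
proof -
  define M where "M = Max (range (\<lambda>(i, j). norm (X$i$j)))"
  have M: "norm (X$i$j) \<le> M" for i j
    unfolding M_def by (rule Max_ge) auto
  have "summable (\<lambda>n. inverse (fact n) * (3 * M * norm z) ^ n)"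
    using summable_exp by (simp add: mult.commute)
  then show ?thesis
  proof (rule summable_comparison_test')
    show "norm (mpow X n $ i $ j / fact n * z ^ n) \<le> inverse (fact n) * (3 * M * norm z) ^ n" for n
      using mult_right_mono[OF mpow_bound[of X M n i j, OF M], of "norm z ^ n / fact n"]
      by (simp add: norm_mult norm_divide norm_power power_mult_distrib field_simps)
  qed
qed

lemma mexp_sums: "(\<lambda>n. (1 / fact n) *\<^sub>R mpow X n) sums mexp X"
proof -
  have "(\<lambda>n. ((1 / fact n) *\<^sub>R mpow X n) $ i $ j) sums (\<Sum>n. mpow X n $ i $ j / fact n)" for i j
    using summable_sums[OF mpow_series_summable[of X i j 1]] by (simp add: scaleR_conv_of_real[where 'a = complex])
  then have "(\<lambda>n. (1 / fact n) *\<^sub>R mpow X n) sums (\<chi> i j. \<Sum>n. mpow X n $ i $ j / fact n)"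
    unfolding sums_def by (intro vec_tendstoI) (simp add: sum_component)
  then show ?thesis
    unfolding mexp_def by (simp add: sums_iff)
qed

lemma mpow_scaleR: "mpow (t *\<^sub>R X) n = t ^ n *\<^sub>R mpow X n"
  by (induction n) (auto simp: vec_eq_iff matrix_mult_nth3 scaleR_conv_of_real[where 'a = complex] algebra_simps)

lemma mexp_scaleR_nth:
  "mexp (t *\<^sub>R X) $ i $ j = (\<Sum>n. mpow X n $ i $ j / fact n * of_real t ^ n)"
proof -
  have "bounded_linear (\<lambda>A::cmat. A $ i $ j)"
    using bounded_linear_compose[OF bounded_linear_vec_nth bounded_linear_vec_nth] .
  from bounded_linear.sums[OF this mexp_sums[of "t *\<^sub>R X"]] show ?thesis
    by (simp add: mpow_scaleR scaleR_conv_of_real[where 'a = complex] sums_iff mult.commute)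
qed

text \<open>Every entry of \<open>exp(t X)\<close> is an entire power series in \<open>t\<close>, which may be differentiated term by term.\<close>

lemma mexp_has_vector_derivative:
  "((\<lambda>t. mexp (t *\<^sub>R X) $ i $ j) has_vector_derivative (X ** mexp (t *\<^sub>R X)) $ i $ j) (at t)"
proof -
  define c where "c = (\<lambda>i n. mpow X n $ i $ j / fact n)"
  have c: "diffs (c i) = (\<lambda>n. X$i$1 * c 1 n + X$i$2 * c 2 n + X$i$3 * c 3 n)"
    by (rule ext) (simp add: diffs_def c_def matrix_mult_nth3 field_simps del: of_nat_Suc)
  have s: "summable (\<lambda>n. c k n * z ^ n)" for k z
    unfolding c_def by (rule mpow_series_summable)
  have "((\<lambda>z. \<Sum>n. c i n * z ^ n) has_field_derivative (\<Sum>n. diffs (c i) n * of_real t ^ n)) (at (of_real t))"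
    by (rule termdiffs_strong_converges_everywhere) (rule s)
  also have "(\<Sum>n. diffs (c i) n * of_real t ^ n)
      = X$i$1 * (\<Sum>n. c 1 n * of_real t ^ n) + X$i$2 * (\<Sum>n. c 2 n * of_real t ^ n)
        + X$i$3 * (\<Sum>n. c 3 n * of_real t ^ n)"
    by (simp add: c distrib_right mult.assoc suminf_add[symmetric] suminf_mult[symmetric] s
        summable_add summable_mult)
  finally show ?thesis
    unfolding mexp_scaleR_nth matrix_mult_nth3
    using has_vector_derivative_real_field by (fastforce simp: c_def)
qed

lemma mexp_zero: "mexp 0 = mat 1"
  using mexp_scaleR_nth[of 0 0] suminf_finite[of "{0}" "\<lambda>n. mpow 0 n $ _ $ _ / fact n * 0 ^ n"]
  by (simp add: vec_eq_iff)

lemma vector_derivative_zero_eq: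
  fixes f :: "real \<Rightarrow> 'a::real_normed_vector"
  assumes "\<And>t. (f has_vector_derivative 0) (at t)"
  shows "f a = f b"
proof -
  obtain c where "f t = c" if "t \<in> UNIV" for t
    by (rule has_vector_derivative_zero_constant[OF convex_UNIV]) (use assms in auto)
  then show ?thesis
    by simp
qed

text \<open>For skew-Hermitian \<open>X\<close> the derivative of \<open>E\<^sup>* E\<close> along \<open>E = exp(t X)\<close> is \<open>E\<^sup>* (X\<^sup>* + X) E = 0\<close>.\<close>

lemma mexp_unitary:
  assumes X: "ctranspose X = - X"
  shows "mexp (t *\<^sub>R X) \<in> unitary_group"
proof -
  define E where "E t = mexp (t *\<^sub>R X)" for t
  have skew: "cnj (X$i$j) = - (X$j$i)" for i j
    using X by (metis ctranspose_nth vector_uminus_component)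
  have d: "((\<lambda>t. E t $ i $ j) has_vector_derivative (X ** E t) $ i $ j) (at t)" for i j t
    unfolding E_def by (rule mexp_has_vector_derivative)
  have "((\<lambda>t. (ctranspose (E t) ** E t) $ i $ j) has_vector_derivative 0) (at t)" for i j t
    unfolding matrix_mult_nth3 ctranspose_nth
    by (rule has_vector_derivative_eq_rhs, (rule derivative_intros d has_vector_derivative_cnj)+)
       (simp add: matrix_mult_nth3 skew algebra_simps)
  then have "(ctranspose (E t) ** E t) $ i $ j = (ctranspose (E 0) ** E 0) $ i $ j" for i j
    by (rule vector_derivative_zero_eq)
  then have "ctranspose (E t) ** E t = ctranspose (E 0) ** E 0"
    by (simp add: vec_eq_iff)
  then show ?thesis
    by (simp add: unitary_group_def E_def mexp_zero)
qed

text \<open>The derivative of the determinant along \<open>E' = X E\<close> is \<open>tr X \<cdot> det E\<close>.\<close>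

lemma det_mexp:
  assumes X: "trace X = 0"
  shows "det (mexp (t *\<^sub>R X)) = 1"
proof -
  define E where "E t = mexp (t *\<^sub>R X)" for t
  have tr: "X$3$3 = - X$1$1 - X$2$2"
    using X by (simp add: trace_def sum_3 add_eq_0_iff)
  have d: "((\<lambda>t. E t $ i $ j) has_vector_derivative (X ** E t) $ i $ j) (at t)" for i j t
    unfolding E_def by (rule mexp_has_vector_derivative)
  have "((\<lambda>t. det (E t)) has_vector_derivative 0) (at t)" for t
    unfolding det_3
    by (rule has_vector_derivative_eq_rhs, (rule derivative_intros d)+)
       (simp add: matrix_mult_nth3 tr algebra_simps)
  then have "det (E t) = det (E 0)"
    by (rule vector_derivative_zero_eq)
  then show ?thesis
    by (simp add: E_def mexp_zero)
qed

lemma mexp_SU3: "ctranspose X = - X \<Longrightarrow> trace X = 0 \<Longrightarrow> mexp (t *\<^sub>R X) \<in> SU3"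
  by (simp add: SU3_def mexp_unitary det_mexp)

lemma mexp_conjugate:
  assumes P: "P \<in> unitary_group"
  shows "mexp (ctranspose P ** X ** P) = ctranspose P ** mexp X ** P"
proof -
  have pow: "mpow (ctranspose P ** X ** P) n = ctranspose P ** mpow X n ** P" for n
    by (induction n) (simp_all add: unitary_left[OF P] unitary_cancel[OF P] flip: matrix_mul_assoc)
  have "linear (\<lambda>A. ctranspose P ** A ** P)"
    by (intro linearI) (simp_all add: vec_eq_iff matrix_mult_nth3 scaleR_conv_of_real[where 'a = complex] algebra_simps)
  then have "bounded_linear (\<lambda>A. ctranspose P ** A ** P)"
    using linear_conv_bounded_linear by blast
  from bounded_linear.sums[OF this mexp_sums[of X]]
  have "(\<lambda>n. (1 / fact n) *\<^sub>R mpow (ctranspose P ** X ** P) n) sums (ctranspose P ** mexp X ** P)"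
    by (simp add: pow linear_cmul[OF \<open>linear _\<close>])
  then show ?thesis
    using mexp_sums sums_unique2 by blast
qed

section \<open>Smooth functions\<close>

lemma Ck_cong:
  assumes "open U" "\<And>x. x \<in> U \<Longrightarrow> f x = g x" "Ck k U f"
  shows "Ck k U g"
  using assms(2,3)
proof (induction k arbitrary: f g)
  case 0
  then show ?case
    using continuous_on_cong[of U U f g] by auto
next
  case (Suc k)
  have g: "g differentiable (at x)"
      "frechet_derivative g (at x) = frechet_derivative f (at x)" if "x \<in> U" for x
  proof -
    have f: "f differentiable (at x)"
      using Suc.prems that by auto
    show "frechet_derivative g (at x) = frechet_derivative f (at x)"
      using frechet_derivative_transform_within_open[OF f \<open>open U\<close> that Suc.prems(1)] by simp
    show "g differentiable (at x)"
      using f Suc.prems(1) has_derivative_transform_within_open[OF _ \<open>open U\<close> that]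
      unfolding differentiable_def by blast
  qed
  have "Ck k U (\<lambda>x. frechet_derivative g (at x) v)" for v
    using Suc.IH[of "\<lambda>x. frechet_derivative f (at x) v" "\<lambda>x. frechet_derivative g (at x) v"]
      Suc.prems g by auto
  then show ?case
    using g by auto
qed

lemma Ck_mono: "Ck k U f \<Longrightarrow> V \<subseteq> U \<Longrightarrow> Ck k V f"
  by (induction k arbitrary: f) (auto intro: continuous_on_subset)

lemma Ck_lower: "Ck (Suc k) U f \<Longrightarrow> Ck k U f"
proof (induction k arbitrary: f)
  case 0
  then have "f differentiable_on U"
    by (auto simp: differentiable_on_def intro: differentiable_at_withinI)
  then show ?case
    by (simp add: differentiable_imp_continuous_on)
next
  case (Suc k)
  then show ?case
    by (metis Ck.simps(2))
qed

lemma Ck_lincomb: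
  fixes f g :: "'a::real_normed_vector \<Rightarrow> real"
  assumes "open U"
  shows "Ck k U f \<Longrightarrow> Ck k U g \<Longrightarrow> Ck k U (\<lambda>x. a * f x + b * g x)"
proof (induction k arbitrary: f g)
  case 0
  then show ?case
    by (auto intro!: continuous_intros)
next
  case (Suc k)
  have d: "((\<lambda>x. a * f x + b * g x) has_derivative
      (\<lambda>v. a * frechet_derivative f (at x) v + b * frechet_derivative g (at x) v)) (at x)"
    if "x \<in> U" for x
    using Suc.prems that
    by (intro has_derivative_add has_derivative_mult_right) (auto simp: frechet_derivative_works)
  have "Ck k U (\<lambda>x. frechet_derivative (\<lambda>x. a * f x + b * g x) (at x) v)" for v
  proof (rule Ck_cong[OF assms])
    show "Ck k U (\<lambda>x. a * frechet_derivative f (at x) v + b * frechet_derivative g (at x) v)"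
      using Suc by auto
  qed (use fun_cong[OF frechet_derivative_at[OF d]] in simp)
  then show ?case
    using d by (auto simp: differentiable_def)
qed

text \<open>The class \<open>Ck (Suc k)\<close> asks for differentiability at every point and for \<open>Ck k\<close> of every directional
  derivative, so the induction uses the product rule and that \<open>f\<close> itself is in \<open>Ck k\<close>.\<close>

lemma Ck_mult:
  fixes f g :: "'a::real_normed_vector \<Rightarrow> real"
  assumes "open U"
  shows "Ck k U f \<Longrightarrow> Ck k U g \<Longrightarrow> Ck k U (\<lambda>x. f x * g x)"
proof (induction k arbitrary: f g)
  case 0
  then show ?case
    by (auto intro!: continuous_intros)
next
  case (Suc k)
  have d: "((\<lambda>x. f x * g x) has_derivative
      (\<lambda>v. f x * frechet_derivative g (at x) v + frechet_derivative f (at x) v * g x)) (at x)"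
    if "x \<in> U" for x
    using Suc.prems that by (intro has_derivative_mult) (auto simp: frechet_derivative_works)
  have "Ck k U (\<lambda>x. frechet_derivative (\<lambda>x. f x * g x) (at x) v)" for v
  proof (rule Ck_cong[OF assms])
    have "Ck k U f" "Ck k U g"
      using Suc.prems by (auto intro: Ck_lower simp del: Ck.simps)
    then have "Ck k U (\<lambda>x. f x * frechet_derivative g (at x) v)"
        "Ck k U (\<lambda>x. frechet_derivative f (at x) v * g x)"
      using Suc by auto
    from Ck_lincomb[OF assms this, of 1 1]
    show "Ck k U (\<lambda>x. f x * frechet_derivative g (at x) v + frechet_derivative f (at x) v * g x)"
      by simp
  qed (use fun_cong[OF frechet_derivative_at[OF d]] in simp)
  then show ?case
    using d by (auto simp: differentiable_def)
qed

lemma Ck_compose_linear: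
  fixes L :: "'a::real_normed_vector \<Rightarrow> 'b::real_normed_vector" and f :: "'b \<Rightarrow> 'c::real_normed_vector"
  assumes L: "bounded_linear L" and "open U"
  shows "Ck k U f \<Longrightarrow> Ck k (L -` U) (f \<circ> L)"
proof (induction k arbitrary: f)
  case 0
  have "continuous_on (L -` U) L"
    using L by (simp add: linear_continuous_on)
  then show ?case
    using 0 continuous_on_compose[of "L -` U" L f] continuous_on_subset[of U f "L ` (L -` U)"]
    by auto
next
  case (Suc k)
  have open_preimage: "open (L -` U)"
    using L \<open>open U\<close> by (simp add: continuous_open_vimage linear_continuous_at)
  have d: "(f \<circ> L has_derivative frechet_derivative f (at (L x)) \<circ> L) (at x)" if "L x \<in> U" for x
    using Suc.prems that L
    by (intro diff_chain_at) (auto simp: frechet_derivative_works bounded_linear_imp_has_derivative)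
  have "Ck k (L -` U) (\<lambda>x. frechet_derivative (f \<circ> L) (at x) v)" for v
  proof (rule Ck_cong[OF open_preimage])
    show "Ck k (L -` U) ((\<lambda>y. frechet_derivative f (at y) (L v)) \<circ> L)"
      by (intro Suc.IH) (use Suc.prems in auto)
    show "((\<lambda>y. frechet_derivative f (at y) (L v)) \<circ> L) x = frechet_derivative (f \<circ> L) (at x) v"
      if "x \<in> L -` U" for x
      using frechet_derivative_at[OF d] that by (metis comp_apply vimageE)
  qed
  then show ?case
    using d unfolding Ck.simps differentiable_def by blast
qed

lemma smooth_fun_lincomb:
  assumes "smooth_fun G F" "smooth_fun G F'"
  shows "smooth_fun G (\<lambda>x. a * F x + b * F' x)"
  unfolding smooth_fun_def
proof
  fix g assume g: "g \<in> G"
  obtain U E where U: "open U" "g \<in> U" "smooth_on U E" "\<forall>x\<in>U \<inter> G. E x = F x"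
    using assms(1) g unfolding smooth_fun_def by blast
  obtain U' E' where U': "open U'" "g \<in> U'" "smooth_on U' E'" "\<forall>x\<in>U' \<inter> G. E' x = F' x"
    using assms(2) g unfolding smooth_fun_def by blast
  have "smooth_on (U \<inter> U') (\<lambda>x. a * E x + b * E' x)"
    using U U' unfolding smooth_on_def
    by (auto intro!: Ck_lincomb elim: Ck_mono)
  then show "\<exists>U E. open U \<and> g \<in> U \<and> smooth_on U E \<and> (\<forall>x\<in>U \<inter> G. E x = a * F x + b * F' x)"
    using U U' by (intro exI[of _ "U \<inter> U'"] exI[of _ "\<lambda>x. a * E x + b * E' x"]) auto
qed

lemma smooth_fun_mult:
  assumes "smooth_fun G F" "smooth_fun G F'"
  shows "smooth_fun G (\<lambda>x. F x * F' x)"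
  unfolding smooth_fun_def
proof
  fix g assume g: "g \<in> G"
  obtain U E where U: "open U" "g \<in> U" "smooth_on U E" "\<forall>x\<in>U \<inter> G. E x = F x"
    using assms(1) g unfolding smooth_fun_def by blast
  obtain U' E' where U': "open U'" "g \<in> U'" "smooth_on U' E'" "\<forall>x\<in>U' \<inter> G. E' x = F' x"
    using assms(2) g unfolding smooth_fun_def by blast
  have "smooth_on (U \<inter> U') (\<lambda>x. E x * E' x)"
    using U U' unfolding smooth_on_def
    by (auto intro!: Ck_mult elim: Ck_mono)
  then show "\<exists>U E. open U \<and> g \<in> U \<and> smooth_on U E \<and> (\<forall>x\<in>U \<inter> G. E x = F x * F' x)"
    using U U' by (intro exI[of _ "U \<inter> U'"] exI[of _ "\<lambda>x. E x * E' x"]) auto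
qed

lemma Ck_const: "Ck k U (\<lambda>x. c)"
  by (induction k arbitrary: c) (auto simp: frechet_derivative_const)

lemma smooth_fun_one: "smooth_fun G (\<lambda>x. 1)"
  unfolding smooth_fun_def
proof
  fix g assume "g \<in> G"
  show "\<exists>U F'. open U \<and> g \<in> U \<and> smooth_on U F' \<and> (\<forall>x\<in>U \<inter> G. F' x = (1::real))"
    by (rule exI[of _ UNIV], rule exI[of _ "\<lambda>_. 1"]) (auto simp: smooth_on_def Ck_const)
qed

lemma smooth_fun_cong:
  assumes "smooth_fun G F" "\<And>x. x \<in> G \<Longrightarrow> F x = F' x"
  shows "smooth_fun G F'"
  using assms unfolding smooth_fun_def by (metis IntE)

text \<open>Used for left and right translations, which are restrictions of linear maps of the space of
  all matrices.\<close>

lemma smooth_fun_compose_linear: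
  assumes "smooth_fun G F" "linear L" "\<And>x. x \<in> H \<Longrightarrow> L x \<in> G"
  shows "smooth_fun H (F \<circ> L)"
  unfolding smooth_fun_def
proof
  fix h assume "h \<in> H"
  then obtain U E where U: "open U" "L h \<in> U" "smooth_on U E" "\<forall>x\<in>U \<inter> G. E x = F x"
    using assms unfolding smooth_fun_def by blast
  have L: "bounded_linear L"
    using \<open>linear L\<close> linear_conv_bounded_linear by blast
  have "open (L -` U)"
    using U L by (auto simp: continuous_open_vimage linear_continuous_at)
  moreover have "smooth_on (L -` U) (E \<circ> L)"
    using U Ck_compose_linear[OF L \<open>open U\<close>] unfolding smooth_on_def by blast
  ultimately show "\<exists>U E. open U \<and> h \<in> U \<and> smooth_on U E \<and> (\<forall>x\<in>U \<inter> H. E x = (F \<circ> L) x)"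
    using U assms(3) by (intro exI[of _ "L -` U"] exI[of _ "E \<circ> L"]) auto
qed

lemma linear_matrix_mult_left: "linear (\<lambda>X::cmat. g ** X)"
  and linear_matrix_mult_right: "linear (\<lambda>X::cmat. X ** g)"
  by (auto intro!: linearI
      simp: vec_eq_iff matrix_matrix_mult_def
        scaleR_sum_right algebra_simps sum.distrib)

section \<open>Transport of structure along a diffeomorphism\<close>

text \<open>The properties of the algebra of smooth functions of a quotient that are needed
  below.  The last one reflects that functions are total, while only their values on \<open>S\<close> matter.\<close>

locale function_algebra =
  fixes S :: "'p set" and C :: "('p \<Rightarrow> real) set"
  assumes lincomb: "F \<in> C \<Longrightarrow> G \<in> C \<Longrightarrow> (\<lambda>x. a * F x + b * G x) \<in> C"
    and mult: "F \<in> C \<Longrightarrow> G \<in> C \<Longrightarrow> (\<lambda>x. F x * G x) \<in> C"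
    and one: "(\<lambda>x. 1) \<in> C"
    and cong: "F \<in> C \<Longrightarrow> (\<And>x. x \<in> S \<Longrightarrow> F x = G x) \<Longrightarrow> G \<in> C"
begin

text \<open>A derivation might a priori see values outside \<open>S\<close>.  It does not: the indicator function \<open>ind\<close> of \<open>S\<close> belongs
  to the algebra, and the Leibniz rule applied to \<open>ind \<cdot> (F - G) = 0\<close> at a point of \<open>S\<close> gives
  \<open>D (F - G) = 0\<close>.\<close>

lemma tangent_cong:
  assumes D: "D \<in> tangent_space C p" and p: "p \<in> S" and F: "F \<in> C"
    and eq: "\<And>x. x \<in> S \<Longrightarrow> F x = G x"
  shows "D F = D G"
proof -
  have G: "G \<in> C"
    using cong F eq by blast
  have lin: "D (\<lambda>x. a * H x + b * H' x) = a * D H + b * D H'"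
    and leibniz: "D (\<lambda>x. H x * H' x) = H p * D H' + H' p * D H"
    if "H \<in> C" "H' \<in> C" for H H' a b
    using D that by (auto simp: tangent_space_def)
  define ind where "ind = (\<lambda>x. if x \<in> S then 1 else 0 :: real)"
  define E where "E = (\<lambda>x. 1 * F x + (-1) * G x)"
  have ind: "ind \<in> C"
    using cong[OF one] by (auto simp: ind_def)
  have E: "E \<in> C"
    unfolding E_def by (rule lincomb[OF F G])
  have "(\<lambda>x. ind x * E x) = (\<lambda>x. 0 * F x + 0 * F x)"
    using eq by (auto simp: ind_def E_def)
  then have "D (\<lambda>x. ind x * E x) = 0"
    using lin[OF F F, of 0 0] by simp
  then have "D E = 0"
    using leibniz[OF ind E] p eq by (simp add: ind_def E_def)
  then show ?thesis
    using lin[OF F G, of 1 "-1"] by (simp add: E_def)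
qed

end

locale diffeo = src: function_algebra S C + tgt: function_algebra S' C'
  for S :: "'p set" and C and S' :: "'q set" and C' +
  fixes \<Phi> :: "'p \<Rightarrow> 'q"
  assumes diffeo: "diffeomorphism C S C' S' \<Phi>"
begin

abbreviation inv\<Phi> where "inv\<Phi> \<equiv> inv_into S \<Phi>"

lemma maps_to: "p \<in> S \<Longrightarrow> \<Phi> p \<in> S'"
  and inv_maps_to: "q \<in> S' \<Longrightarrow> inv\<Phi> q \<in> S"
  and inv_left: "p \<in> S \<Longrightarrow> inv\<Phi> (\<Phi> p) = p"
  and inv_right: "q \<in> S' \<Longrightarrow> \<Phi> (inv\<Phi> q) = q"
  using diffeo by (auto simp: diffeomorphism_def bij_betw_def inv_into_into f_inv_into_f)

lemma pullback: "F \<in> C' \<Longrightarrow> F \<circ> \<Phi> \<in> C"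
  and pullback_inv: "G \<in> C \<Longrightarrow> G \<circ> inv\<Phi> \<in> C'"
  using diffeo by (auto simp: diffeomorphism_def)

lemma push_tangent:
  assumes "D \<in> tangent_space C p"
  shows "push C' \<Phi> D \<in> tangent_space C' (\<Phi> p)"
proof -
  have lin: "D (\<lambda>x. a * F x + b * G x) = a * D F + b * D G"
    and leibniz: "D (\<lambda>x. F x * G x) = F p * D G + G p * D F"
    if "F \<in> C" "G \<in> C" for F G a b
    using assms that by (auto simp: tangent_space_def)
  show ?thesis
    unfolding tangent_space_def push_def
    using lin[OF pullback pullback] leibniz[OF pullback pullback]
    by (simp add: tgt.lincomb tgt.mult comp_def)
qed

text \<open>Injectivity of the differential of \<open>\<Phi>\<close>.  A smooth function \<open>F\<close> agrees with the pullback of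
  \<open>F \<circ> inv\<Phi>\<close> on \<open>S\<close> only, whence the use of \<open>tangent_cong\<close>.\<close>

lemma push_eq_zero:
  assumes D: "D \<in> tangent_space C p" "p \<in> S" and zero: "push C' \<Phi> D = (\<lambda>F. 0)"
  shows "D = (\<lambda>F. 0)"
proof
  fix F
  show "D F = 0"
  proof (cases "F \<in> C")
    case True
    have "D F = D (F \<circ> inv\<Phi> \<circ> \<Phi>)"
      by (rule src.tangent_cong[OF D True]) (simp add: inv_left)
    also have "\<dots> = push C' \<Phi> D (F \<circ> inv\<Phi>)"
      by (simp add: push_def pullback_inv True)
    finally show ?thesis
      by (simp add: zero)
  qed (use D in \<open>auto simp: tangent_space_def\<close>)
qed

lemma smooth_map_compose:
  assumes "smooth_map C S A \<psi>"
  shows "smooth_map C' S' A (\<Phi> \<circ> \<psi>)"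
  unfolding smooth_map_def
proof (intro conjI ballI)
  show "range (\<Phi> \<circ> \<psi>) \<subseteq> S'"
    using assms maps_to by (auto simp: smooth_map_def)
  fix F c assume "F \<in> C'" "c \<in> A"
  then have "smooth_on (chart_image c) ((F \<circ> \<Phi>) \<circ> \<psi> \<circ> chart_inv c)"
    using assms pullback[of F] unfolding smooth_map_def by blast
  then show "smooth_on (chart_image c) (F \<circ> (\<Phi> \<circ> \<psi>) \<circ> chart_inv c)"
    by (simp only: comp_assoc)
qed

lemma diff_map_compose: "diff_map C' c (\<Phi> \<circ> \<psi>) p v = push C' \<Phi> (diff_map C c \<psi> p v)"
  by (rule ext) (simp add: diff_map_def push_def pullback comp_assoc)

lemma diff_z_compose: "diff_z C' c (\<Phi> \<circ> \<psi>) p = push C' \<Phi> (diff_z C c \<psi> p)"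
  by (auto simp: diff_z_def diff_map_compose push_def)

lemma diff_map_eqD:
  assumes "range \<psi> \<subseteq> S" "diff_map C' c (\<Phi> \<circ> \<psi>) p v = diff_map C' c (\<Phi> \<circ> \<psi>) p w"
  shows "diff_map C c \<psi> p v = diff_map C c \<psi> p w"
proof
  fix F :: "'p \<Rightarrow> real"
  have "F \<circ> inv\<Phi> \<circ> (\<Phi> \<circ> \<psi>) = F \<circ> \<psi>"
    using assms(1) inv_left by (auto simp: image_subset_iff)
  then show "diff_map C c \<psi> p v F = diff_map C c \<psi> p w F"
    using fun_cong[OF assms(2), of "F \<circ> inv\<Phi>"] pullback_inv
    by (auto simp: diff_map_def)
qed

lemma primitive_compose:
  assumes dist: "\<And>p. p \<in> S \<Longrightarrow> push C' \<Phi> ` \<Delta> p = \<Delta>' (\<Phi> p)"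
    and prim: "primitive C S \<Delta> A \<psi>"
  shows "primitive C' S' \<Delta>' A (\<Phi> \<circ> \<psi>)"
proof -
  have range: "range \<psi> \<subseteq> S"
    using prim by (simp add: primitive_def smooth_map_def)
  have "inj (diff_map C' c (\<Phi> \<circ> \<psi>) p)" if "inj (diff_map C c \<psi> p)" for c p
    by (rule injI) (rule injD[OF that diff_map_eqD[OF range]])
  moreover have "diff_z C' c (\<Phi> \<circ> \<psi>) p \<in> \<Delta>' ((\<Phi> \<circ> \<psi>) p)" if "diff_z C c \<psi> p \<in> \<Delta> (\<psi> p)" for c p
    using that dist[of "\<psi> p"] range by (auto simp: diff_z_compose)
  ultimately show ?thesis
    using prim smooth_map_compose unfolding primitive_def by blast
qed

definition pullback_metric where
  "pullback_metric h p D D' = h (\<Phi> p) (push C' \<Phi> D) (push C' \<Phi> D')"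

lemma push_lincomb:
  "push C' \<Phi> (\<lambda>F. a * D F + b * D' F) = (\<lambda>F. a * push C' \<Phi> D F + b * push C' \<Phi> D' F)"
  for D D' :: "('p \<Rightarrow> real) \<Rightarrow> real"
  by (auto simp: push_def)

text \<open>Positivity uses injectivity of the differential, and invariance that \<open>\<Phi>\<close> intertwines the two
  actions on \<open>S\<close>.\<close>

lemma invariant_pullback_metric:
  assumes equivariant: "\<And>g p. g \<in> SU3 \<Longrightarrow> p \<in> S \<Longrightarrow> \<Phi> (act g p) = act' g (\<Phi> p)"
    and act: "\<And>g F. g \<in> SU3 \<Longrightarrow> F \<in> C \<Longrightarrow> F \<circ> act g \<in> C"
    and act': "\<And>g F. g \<in> SU3 \<Longrightarrow> F \<in> C' \<Longrightarrow> F \<circ> act' g \<in> C'"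
    and h: "invariant_metric C' S' act' h"
  shows "invariant_metric C S act (pullback_metric h)"
proof -
  \<comment> \<open>Off \<open>S\<close> the maps \<open>\<Phi> \<circ> act g\<close> and \<open>act' g \<circ> \<Phi>\<close> may differ, but tangent vectors at points of \<open>S\<close>
    do not notice this.\<close>
  have push_act: "push C' \<Phi> (push C (act g) D) = push C' (act' g) (push C' \<Phi> D)"
    if g: "g \<in> SU3" and p: "p \<in> S" and D: "D \<in> tangent_space C p" for g p D
  proof
    fix F
    show "push C' \<Phi> (push C (act g) D) F = push C' (act' g) (push C' \<Phi> D) F"
    proof (cases "F \<in> C'")
      case True
      have "D (F \<circ> \<Phi> \<circ> act g) = D (F \<circ> act' g \<circ> \<Phi>)"
        using equivariant[OF g]
        by (intro src.tangent_cong[OF D p] act[OF g] pullback True) auto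
      then show ?thesis
        using True act'[OF g True] pullback by (simp add: push_def)
    qed (simp add: push_def)
  qed
  have sym: "h q D D' = h q D' D"
    and lin: "h q (\<lambda>F. a * D F + b * D' F) D'' = a * h q D D'' + b * h q D' D''"
    and pos: "D \<noteq> (\<lambda>F. 0) \<Longrightarrow> h q D D > 0"
    and inv: "g \<in> SU3 \<Longrightarrow> h (act' g q) (push C' (act' g) D) (push C' (act' g) D') = h q D D'"
    if "q \<in> S'" "D \<in> tangent_space C' q" "D' \<in> tangent_space C' q" "D'' \<in> tangent_space C' q"
    for q D D' D'' a b g
    using h that unfolding invariant_metric_def by blast+
  show ?thesis
    unfolding invariant_metric_def pullback_metric_def push_lincomb
  proof (intro conjI ballI allI impI)
    fix p D D' assume p: "p \<in> S" and D: "D \<in> tangent_space C p" "D' \<in> tangent_space C p"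
    note tangent = maps_to[OF p] push_tangent[OF D(1)] push_tangent[OF D(2)]
    show "h (\<Phi> p) (push C' \<Phi> D) (push C' \<Phi> D') = h (\<Phi> p) (push C' \<Phi> D') (push C' \<Phi> D)"
      by (rule sym[OF tangent tangent(3)])
    show "h (\<Phi> p) (\<lambda>F. a * push C' \<Phi> D F + b * push C' \<Phi> D' F) (push C' \<Phi> D'') =
        a * h (\<Phi> p) (push C' \<Phi> D) (push C' \<Phi> D'') + b * h (\<Phi> p) (push C' \<Phi> D') (push C' \<Phi> D'')"
      if "D'' \<in> tangent_space C p" for D'' a b
      by (rule lin[OF tangent push_tangent[OF that]])
    show "0 < h (\<Phi> p) (push C' \<Phi> D) (push C' \<Phi> D)" if "D \<noteq> (\<lambda>F. 0)"
      using pos[OF tangent tangent(3)] push_eq_zero[OF D(1) p] that by blast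
    show "h (\<Phi> (act g p)) (push C' \<Phi> (push C (act g) D)) (push C' \<Phi> (push C (act g) D')) =
        h (\<Phi> p) (push C' \<Phi> D) (push C' \<Phi> D')" if g: "g \<in> SU3" for g
      unfolding push_act[OF g p D(1)] push_act[OF g p D(2)] equivariant[OF g p]
      by (rule inv[OF tangent tangent(3) g])
  qed
qed

lemma isotropic_pullback_metric:
  assumes dist: "\<And>p. p \<in> S \<Longrightarrow> push C' \<Phi> ` \<Delta> p = \<Delta>' (\<Phi> p)"
    and h: "isotropic S' \<Delta>' h"
  shows "isotropic S \<Delta> (pullback_metric h)"
  unfolding isotropic_def
proof (intro ballI)
  fix p D D' assume p: "p \<in> S" and D: "D \<in> \<Delta> p" "D' \<in> \<Delta> p"
  have comp: "push C' \<Phi> (Re \<circ> D) = Re \<circ> push C' \<Phi> D" "push C' \<Phi> (Im \<circ> D) = Im \<circ> push C' \<Phi> D"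
    for D :: "('p \<Rightarrow> real) \<Rightarrow> complex"
    by (auto simp: push_def)
  have "push C' \<Phi> D \<in> \<Delta>' (\<Phi> p)" "push C' \<Phi> D' \<in> \<Delta>' (\<Phi> p)"
    using dist[OF p] D by auto
  then have "complex_bilinear (h (\<Phi> p)) (push C' \<Phi> D) (push C' \<Phi> D') = 0"
    using h maps_to[OF p] by (auto simp: isotropic_def)
  then show "complex_bilinear (pullback_metric h p) D D' = 0"
    by (simp add: complex_bilinear_def pullback_metric_def comp)
qed

lemma energy_pullback_metric:
  "energy C (pullback_metric h) c K \<psi> = energy C' h c K (\<Phi> \<circ> \<psi>)"
  by (simp add: energy_def pullback_metric_def diff_map_compose)

text \<open>A variation \<open>\<Psi>\<close> of \<open>\<Phi> \<circ> \<psi>\<close> is the image under \<open>\<Phi>\<close> of the variation \<open>\<Theta> = inv\<Phi> \<circ> \<Psi>\<close> of \<open>\<psi>\<close>, and the two have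
  the same energies for small times.\<close>

lemma harmonic_compose:
  assumes harm: "harmonic C S (pullback_metric h) A \<psi>"
  shows "harmonic C' S' h A (\<Phi> \<circ> \<psi>)"
  unfolding harmonic_def
proof (intro conjI ballI allI impI)
  have smooth: "smooth_map C S A \<psi>"
    using harm by (simp add: harmonic_def)
  then show "smooth_map C' S' A (\<Phi> \<circ> \<psi>)"
    by (rule smooth_map_compose)
  have range: "\<psi> p \<in> S" for p
    using smooth by (auto simp: smooth_map_def)
  fix c K \<delta> \<Psi>
  assume c: "c \<in> A" and K: "compact K \<and> K \<subseteq> chart_image c"
    and \<Psi>: "variation C' S' A (\<Phi> \<circ> \<psi>) (chart_inv c ` K) \<delta> \<Psi>"
  define \<Theta> where "\<Theta> t = inv\<Phi> \<circ> \<Psi> t" for t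
  have \<Psi>_range: "\<Psi> t p \<in> S'" if "t \<in> {-\<delta><..<\<delta>}" for t p
    using \<Psi> that by (auto simp: variation_def image_subset_iff)
  have \<delta>: "\<delta> > 0"
    using \<Psi> by (simp add: variation_def)
  have "variation C S A \<psi> (chart_inv c ` K) \<delta> \<Theta>"
    unfolding variation_def
  proof (intro conjI ballI allI impI)
    show "\<Theta> 0 = \<psi>"
      using \<Psi> inv_left range by (auto simp: variation_def \<Theta>_def)
    show "range (\<Theta> t) \<subseteq> S" if "t \<in> {-\<delta><..<\<delta>}" for t
      using \<Psi>_range[OF that] inv_maps_to by (auto simp: \<Theta>_def)
    show "\<Theta> t p = \<psi> p" if "t \<in> {-\<delta><..<\<delta>}" "p \<notin> chart_inv c ` K" for t p
      using \<Psi> that inv_left range by (auto simp: \<Theta>_def variation_def)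
    show "smooth_on ({-\<delta><..<\<delta>} \<times> chart_image c') (\<lambda>(t, z). F (\<Theta> t (chart_inv c' z)))"
      if "F \<in> C" "c' \<in> A" for F c'
    proof -
      have "smooth_on ({-\<delta><..<\<delta>} \<times> chart_image c') (\<lambda>(t, z). (F \<circ> inv\<Phi>) (\<Psi> t (chart_inv c' z)))"
        using \<Psi> that pullback_inv unfolding variation_def by blast
      then show ?thesis
        by (simp add: \<Theta>_def)
    qed
  qed (rule \<delta>)
  then have "((\<lambda>t. energy C (pullback_metric h) c K (\<Theta> t)) has_real_derivative 0) (at 0)"
    using harm c K unfolding harmonic_def by blast
  moreover have "energy C (pullback_metric h) c K (\<Theta> t) = energy C' h c K (\<Psi> t)"
    if "t \<in> {-\<delta><..<\<delta>}" for t
  proof -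
    have "\<Phi> \<circ> \<Theta> t = \<Psi> t"
      using \<Psi>_range[OF that] inv_right by (auto simp: \<Theta>_def)
    then show ?thesis
      by (simp add: energy_pullback_metric)
  qed
  ultimately show "((\<lambda>t. energy C' h c K (\<Psi> t)) has_real_derivative 0) (at 0)"
    using \<delta> by (elim has_field_derivative_transform_within_open[where S="{-\<delta><..<\<delta>}"]) auto
qed

lemma primitive_harmonic_compose:
  assumes dist: "\<And>p. p \<in> S \<Longrightarrow> push C' \<Phi> ` \<Delta> p = \<Delta>' (\<Phi> p)"
    and equivariant: "\<And>g p. g \<in> SU3 \<Longrightarrow> p \<in> S \<Longrightarrow> \<Phi> (act g p) = act' g (\<Phi> p)"
    and act: "\<And>g F. g \<in> SU3 \<Longrightarrow> F \<in> C \<Longrightarrow> F \<circ> act g \<in> C"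
    and act': "\<And>g F. g \<in> SU3 \<Longrightarrow> F \<in> C' \<Longrightarrow> F \<circ> act' g \<in> C'"
    and prim: "primitive_harmonic C S act \<Delta> A \<psi>"
  shows "primitive_harmonic C' S' act' \<Delta>' A (\<Phi> \<circ> \<psi>)"
  unfolding primitive_harmonic_def
proof (intro conjI allI impI)
  show "primitive C' S' \<Delta>' A (\<Phi> \<circ> \<psi>)"
    using prim by (intro primitive_compose[of \<Delta> \<Delta>'] dist) (auto simp: primitive_harmonic_def)
  fix h assume h: "invariant_metric C' S' act' h \<and> isotropic S' \<Delta>' h"
  have "invariant_metric C S act (pullback_metric h)"
    using h by (intro invariant_pullback_metric[of act act'] equivariant act act') auto
  moreover have "isotropic S \<Delta> (pullback_metric h)"
    using h by (intro isotropic_pullback_metric[of \<Delta> \<Delta>'] dist) auto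
  ultimately show "harmonic C' S' h A (\<Phi> \<circ> \<psi>)"
    using prim by (intro harmonic_compose) (auto simp: primitive_harmonic_def)
qed

end

section \<open>\<open>\<Phi>\<close> is an equivariant diffeomorphism\<close>

lemma function_algebra_C1: "function_algebra FL1 C1"
proof
  show "(\<lambda>x. a * F x + b * G x) \<in> C1" if "F \<in> C1" "G \<in> C1" for F G a b
    using smooth_fun_lincomb that by (simp add: C1_def comp_def)
  show "(\<lambda>x. F x * G x) \<in> C1" if "F \<in> C1" "G \<in> C1" for F G
    using smooth_fun_mult that by (simp add: C1_def comp_def)
  show "(\<lambda>x. 1) \<in> C1"
    using smooth_fun_one by (simp add: C1_def comp_def)
  show "G \<in> C1" if "F \<in> C1" "\<And>x. x \<in> FL1 \<Longrightarrow> F x = G x" for F G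
    using smooth_fun_cong[of SU3 "F \<circ> pi1" "G \<circ> pi1"] that pi1_in_FL1 by (simp add: C1_def)
qed

lemma function_algebra_C2: "function_algebra FL2 C2"
proof
  show "(\<lambda>x. a * F x + b * G x) \<in> C2" if "F \<in> C2" "G \<in> C2" for F G a b
    using smooth_fun_lincomb that by (simp add: C2_def comp_def)
  show "(\<lambda>x. F x * G x) \<in> C2" if "F \<in> C2" "G \<in> C2" for F G
    using smooth_fun_mult that by (simp add: C2_def comp_def)
  show "(\<lambda>x. 1) \<in> C2"
    using smooth_fun_one by (simp add: C2_def comp_def)
  show "G \<in> C2" if "F \<in> C2" "\<And>x. x \<in> FL2 \<Longrightarrow> F x = G x" for F G
    using smooth_fun_cong[of N2 "F \<circ> pi2" "G \<circ> pi2"] that pi2_in_FL2 by (simp add: C2_def)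
qed

text \<open>Both \<open>\<Phi>\<close> and its inverse are covered by right translations, which are linear on matrices.\<close>

lemma Phi_diffeomorphism: "diffeomorphism C2 FL2 C1 FL1 Phi"
  unfolding diffeomorphism_def
proof (intro conjI ballI Phi_bij)
  fix F assume "F \<in> C1"
  then have "smooth_fun N2 ((F \<circ> pi1) \<circ> (\<lambda>X. X ** frame_change))"
    unfolding C1_def
    by (intro smooth_fun_compose_linear linear_matrix_mult_right) (auto intro: N2_frame_change)
  then show "F \<circ> Phi \<in> C2"
    unfolding C2_def by (simp add: Phi_pi2 smooth_fun_cong)
next
  have inv_pi1: "inv_into FL2 Phi (pi1 g) = pi2 (g ** ctranspose frame_change)" if "g \<in> SU3" for g
  proof (rule inv_into_f_eq)
    show "inj_on Phi FL2"
      using Phi_bij by (simp add: bij_betw_def)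
    show "pi2 (g ** ctranspose frame_change) \<in> FL2"
      by (intro pi2_in_FL2 SU3_frame_change that)
    show "Phi (pi2 (g ** ctranspose frame_change)) = pi1 g"
      by (simp add: Phi_pi2 SU3_frame_change that unitary_cancel frame_change_unitary)
  qed
  fix F assume "F \<in> C2"
  then have "smooth_fun SU3 ((F \<circ> pi2) \<circ> (\<lambda>X. X ** ctranspose frame_change))"
    unfolding C2_def
    by (intro smooth_fun_compose_linear linear_matrix_mult_right) (auto intro: SU3_frame_change)
  then show "F \<circ> inv_into FL2 Phi \<in> C1"
    unfolding C1_def by (simp add: inv_pi1 smooth_fun_cong)
qed

interpretation Phi: diffeo FL2 C2 FL1 C1 Phi
  by (intro diffeo.intro diffeo_axioms.intro function_algebra_C1 function_algebra_C2
      Phi_diffeomorphism)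

lemma act1_pi1: "act1 g (pi1 h) = pi1 (g ** h)"
  by (simp add: act1_def pi1_def matrix_vector_mul_assoc image_image matrix_mul_assoc)

lemma act2_pi2: "act2 g (pi2 n) = pi2 (g ** n)"
proof -
  have "(*v) g ` vec.span {a, b} = vec.span {g *v a, g *v b}" for a b
    unfolding span_pair by (force simp: matrix_vector_right_distrib vector_scalar_commute)
  then show ?thesis
    by (simp add: act2_def pi2_def matrix_vector_mul_assoc)
qed

lemma Phi_equivariant: "g \<in> SU3 \<Longrightarrow> p \<in> FL2 \<Longrightarrow> Phi (act2 g p) = act1 g (Phi p)"
  by (metis FL2_obtain_frame act1_pi1 act2_pi2 Phi_pi2 SU3_mult_N2 matrix_mul_assoc)

lemma C1_act1:
  assumes g: "g \<in> SU3" and F: "F \<in> C1"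
  shows "F \<circ> act1 g \<in> C1"
proof -
  have "smooth_fun SU3 ((F \<circ> pi1) \<circ> (\<lambda>X. g ** X))"
    using F unfolding C1_def
    by (intro smooth_fun_compose_linear linear_matrix_mult_left) (auto intro: SU3_mult g)
  then show ?thesis
    unfolding C1_def by (simp add: act1_pi1 smooth_fun_cong)
qed

lemma C2_act2:
  assumes g: "g \<in> SU3" and F: "F \<in> C2"
  shows "F \<circ> act2 g \<in> C2"
proof -
  have "smooth_fun N2 ((F \<circ> pi2) \<circ> (\<lambda>X. g ** X))"
    using F unfolding C2_def
    by (intro smooth_fun_compose_linear linear_matrix_mult_left) (auto intro: SU3_mult_N2 g)
  then show ?thesis
    unfolding C2_def by (simp add: act2_pi2 smooth_fun_cong)
qed

section \<open>The primitive distributions\<close>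

text \<open>\<open>\<Phi>\<close> carries the curve \<open>n exp(t Y)\<close> to \<open>n exp(t Y) P = (n P) exp(t P\<^sup>* Y P)\<close>.  The hypotheses on
  \<open>Y\<close> keep the first curve inside \<open>N2\<close>, where \<open>\<Phi>\<close> is given by right translation.\<close>

lemma push_velocity:
  assumes n: "n \<in> N2" and Y: "ctranspose Y = - Y" "trace Y = 0"
  shows "push C1 Phi (velocity C2 pi2 n Y) =
    velocity C1 pi1 (n ** frame_change) (ctranspose frame_change ** Y ** frame_change)"
proof
  fix F
  have "Phi (pi2 (n ** mexp (t *\<^sub>R Y))) =
      pi1 (n ** frame_change ** mexp (t *\<^sub>R (ctranspose frame_change ** Y ** frame_change)))" for t
  proof -
    have "t *\<^sub>R (ctranspose frame_change ** Y ** frame_change) =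
        ctranspose frame_change ** (t *\<^sub>R Y) ** frame_change"
      by (simp add: linear_cmul[OF linear_matrix_mult_left] linear_cmul[OF linear_matrix_mult_right])
    then have "n ** frame_change ** mexp (t *\<^sub>R (ctranspose frame_change ** Y ** frame_change)) =
        n ** mexp (t *\<^sub>R Y) ** frame_change"
      by (simp add: mexp_conjugate frame_change_unitary unitary_cancel matrix_mul_assoc)
    then show ?thesis
      by (simp add: Phi_pi2 N2_mult_SU3 n mexp_SU3 Y)
  qed
  then show "push C1 Phi (velocity C2 pi2 n Y) F =
      velocity C1 pi1 (n ** frame_change) (ctranspose frame_change ** Y ** frame_change) F"
    by (simp add: push_def velocity_def Phi.pullback)
qed

text \<open>Conjugation by the unitary matrix \<open>P\<close> commutes with the conjugate transpose, so it respects the decomposition into two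
  skew-Hermitian parts that defines the complex linear extension.\<close>

lemma push_cvelocity:
  assumes n: "n \<in> N2" and X: "trace X = 0"
  shows "push C1 Phi (cvelocity C2 pi2 n X) =
    cvelocity C1 pi1 (n ** frame_change) (ctranspose frame_change ** X ** frame_change)"
proof
  fix F
  let ?P = frame_change
  have tr: "cnj (X$1$1) + cnj (X$2$2) + cnj (X$3$3) = 0" "X$1$1 + X$2$2 + X$3$3 = 0"
    using X by (simp_all add: trace_def sum_3 flip: complex_cnj_add)
  have "trace (smult_mat a (X - ctranspose X)) = a * ((X$1$1 + X$2$2 + X$3$3) - (cnj (X$1$1) + cnj (X$2$2) + cnj (X$3$3)))"
    "trace (smult_mat a (X + ctranspose X)) = a * ((X$1$1 + X$2$2 + X$3$3) + (cnj (X$1$1) + cnj (X$2$2) + cnj (X$3$3)))" for a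
    by (simp_all add: trace_def sum_3 smult_mat_def algebra_simps)
  then have traces: "trace (smult_mat a (X - ctranspose X)) = 0" "trace (smult_mat a (X + ctranspose X)) = 0" for a
    by (simp_all add: tr)
  have skew: "ctranspose (smult_mat (1/2) (X - ctranspose X)) = - smult_mat (1/2) (X - ctranspose X)"
    "ctranspose (smult_mat (- \<i>/2) (X + ctranspose X)) = - smult_mat (- \<i>/2) (X + ctranspose X)"
    by (simp_all add: vec_eq_iff smult_mat_def algebra_simps)
  have conj: "ctranspose ?P ** smult_mat a (X - ctranspose X) ** ?P =
      smult_mat a (ctranspose ?P ** X ** ?P - ctranspose (ctranspose ?P ** X ** ?P))"
    "ctranspose ?P ** smult_mat a (X + ctranspose X) ** ?P =
      smult_mat a (ctranspose ?P ** X ** ?P + ctranspose (ctranspose ?P ** X ** ?P))" for a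
    by (simp_all add: vec_eq_iff smult_mat_def matrix_mult_nth3 algebra_simps)
  have v: "push C1 Phi (velocity C2 pi2 n Y) F = velocity C1 pi1 (n ** ?P) (ctranspose ?P ** Y ** ?P) F"
    if "ctranspose Y = - Y" "trace Y = 0" for Y
    using push_velocity[OF n that] by simp
  have "push C1 Phi (cvelocity C2 pi2 n X) F =
      of_real (push C1 Phi (velocity C2 pi2 n (smult_mat (1/2) (X - ctranspose X))) F) +
      \<i> * of_real (push C1 Phi (velocity C2 pi2 n (smult_mat (- \<i>/2) (X + ctranspose X))) F)"
    by (simp add: push_def cvelocity_def)
  also have "\<dots> = cvelocity C1 pi1 (n ** ?P) (ctranspose ?P ** X ** ?P) F"
    unfolding v[OF skew(1) traces(1)] v[OF skew(2) traces(2)] conj cvelocity_def ..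
  finally show "push C1 Phi (cvelocity C2 pi2 n X) F =
      cvelocity C1 pi1 (n ** ?P) (ctranspose ?P ** X ** ?P) F" .
qed

lemma eps_eq: "eps = Complex (- 1 / 2) (sqrt 3 / 2)"
proof -
  have "2 * complex_of_real pi * \<i> / 3 = \<i> * of_real (2 * pi / 3)"
    by simp
  then have "eps = cis (2 * pi / 3)"
    unfolding eps_def cis_conv_exp by (rule arg_cong)
  moreover have "cos (2 * pi / 3) = - 1 / 2" "sin (2 * pi / 3) = sqrt 3 / 2"
    using cos_double[of "pi / 3"] sin_double[of "pi / 3"]
    by (simp_all add: cos_60 sin_60 power2_eq_square)
  ultimately show ?thesis
    by (simp add: complex_eq_iff)
qed

lemma eps_facts: "eps * eps * eps = 1" "cnj eps = eps * eps" "eps \<noteq> 1" "eps \<noteq> 0"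
  by (auto simp: eps_eq complex_eq_iff algebra_simps)

text \<open>This is \<open>T S\<^sup>-\<^sup>1\<close>, the product of the permutation matrix and the inverse of the diagonal matrix that
  define the automorphism \<open>\<sigma>\<close> of \<open>sl(3,\<complex>)\<close>; it is its own inverse.\<close>

definition Qmat :: cmat where
  "Qmat = vector [vector [1, 0, 0], vector [0, 0, eps], vector [0, eps * eps, 0]]"

text \<open>The change of frame turns the matrix of the automorphism on \<open>FL1\<close> into that of the automorphism on \<open>FL2\<close>.  It
  acts by congruence, because both automorphisms involve a transpose.\<close>

lemma frame_change_Rmat: "frame_change ** Rmat ** transpose frame_change = Qmat"
proof -
  have s: "complex_of_real (sqrt 2) * complex_of_real (sqrt 2) = 2"
    by (simp flip: of_real_mult)
  have eps: "eps = - of_real (cos (pi / 3)) + \<i> * of_real (sin (pi / 3))"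
    "eps * eps = - of_real (cos (pi / 3)) - \<i> * of_real (sin (pi / 3))"
    by (simp_all add: eps_eq complex_eq_iff cos_60 sin_60)
  show ?thesis
    unfolding Qmat_def unfolding eps(2) unfolding eps(1)
    by (simp add: mat3_eq_iff matrix_mult_nth3 frame_change_def Rmat_def transpose_def field_simps s)
qed

text \<open>The eigenspace description of \<open>g1\<close>, by comparing entries; \<open>eps\<close> is a primitive cube root of
  unity.\<close>

lemma g1_iff_Qmat: "Y \<in> g1 \<longleftrightarrow> Qmat ** transpose Y ** Qmat = smult_mat eps Y"
proof -
  have "Y \<in> g1 \<longleftrightarrow> Y$1$1 = 0 \<and> Y$1$2 = 0 \<and> Y$2$2 = 0 \<and> Y$2$3 = 0 \<and> Y$3$1 = 0 \<and> Y$3$3 = 0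
      \<and> Y$1$3 = Y$2$1"
    by (auto simp: g1_def mat3_eq_iff)
  also have "\<dots> \<longleftrightarrow> Qmat ** transpose Y ** Qmat = smult_mat eps Y"
  proof
    assume "Y$1$1 = 0 \<and> Y$1$2 = 0 \<and> Y$2$2 = 0 \<and> Y$2$3 = 0 \<and> Y$3$1 = 0 \<and> Y$3$3 = 0
      \<and> Y$1$3 = Y$2$1"
    moreover have "eps * eps * Y$3$2 * (eps * eps) = eps * Y$3$2"
      using eps_facts(1) by algebra
    ultimately show "Qmat ** transpose Y ** Qmat = smult_mat eps Y"
      by (simp add: mat3_eq_iff matrix_mult_nth3 Qmat_def smult_mat_def transpose_def)
  next
    assume "Qmat ** transpose Y ** Qmat = smult_mat eps Y"
    then have *: "Y$1$1 = eps * Y$1$1" "Y$3$1 * (eps * eps) = eps * Y$1$2" "Y$2$1 * eps = eps * Y$1$3"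
      "eps * Y$3$3 * (eps * eps) = eps * Y$2$2" "eps * Y$2$3 * eps = eps * Y$2$3"
      "eps * eps * Y$1$2 = eps * Y$3$1" "eps * eps * Y$2$2 * eps = eps * Y$3$3"
      by (simp_all add: mat3_eq_iff matrix_mult_nth3 Qmat_def smult_mat_def transpose_def)
    have "eps - 1 \<noteq> 0" "eps \<noteq> 0"
      using eps_facts by auto
    moreover have "(eps - 1) * Y$1$1 = 0" "(eps - 1) * Y$1$2 = 0" "(eps - 1) * Y$2$2 = 0"
      "eps * (eps - 1) * Y$2$3 = 0" "(eps - 1) * Y$3$1 = 0" "(eps - 1) * Y$3$3 = 0" "eps * (Y$1$3 - Y$2$1) = 0"
      using * eps_facts(1) by algebra+
    ultimately show "Y$1$1 = 0 \<and> Y$1$2 = 0 \<and> Y$2$2 = 0 \<and> Y$2$3 = 0 \<and> Y$3$1 = 0 \<and> Y$3$3 = 0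
      \<and> Y$1$3 = Y$2$1"
      by simp
  qed
  finally show ?thesis .
qed

lemma g1_trace: "X \<in> g1 \<Longrightarrow> trace X = 0"
  by (auto simp: g1_def trace_def sum_3)

text \<open>Conjugation by \<open>P\<close> matches the two order six automorphisms, hence their eigenspaces.\<close>

lemma g1_hat_conj_iff: "ctranspose frame_change ** Y ** frame_change \<in> g1_hat \<longleftrightarrow> Y \<in> g1"
proof -
  let ?P = frame_change
  let ?X = "ctranspose ?P ** Y ** ?P"
  have P: "?P \<in> unitary_group"
    by (rule frame_change_unitary)
  have Rinv: "matrix_inv Rmat = ctranspose Rmat"
    by (simp add: Rmat_eq_rot matrix_inv_unitary SU3_unitary rot_SU3)
  have ct: "ctranspose (ctranspose A ** B ** C) = ctranspose C ** ctranspose B ** A" for A B C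
    by (simp add: ctranspose_mult matrix_mul_assoc)
  have Q': "mcnj ?P ** ctranspose Rmat ** ctranspose ?P = Qmat"
  proof -
    have "mcnj ?P ** ctranspose Rmat ** ctranspose ?P = ctranspose (?P ** Rmat ** transpose ?P)"
      by (simp add: vec_eq_iff matrix_mult_nth3 transpose_def algebra_simps)
    also have "\<dots> = Qmat"
      unfolding frame_change_Rmat
      by (simp add: mat3_eq_iff Qmat_def eps_facts) (use eps_facts(1) in algebra)
    finally show ?thesis .
  qed
  have "transpose ?X = transpose ?P ** transpose Y ** mcnj ?P"
    by (simp add: vec_eq_iff matrix_mult_nth3 transpose_def algebra_simps)
  then have "?P ** (Rmat ** transpose ?X ** matrix_inv Rmat) ** ctranspose ?P =
      (?P ** Rmat ** transpose ?P) ** transpose Y ** (mcnj ?P ** ctranspose Rmat ** ctranspose ?P)"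
    by (simp add: Rinv matrix_mul_assoc)
  then have "?P ** (Rmat ** transpose ?X ** matrix_inv Rmat) ** ctranspose ?P = Qmat ** transpose Y ** Qmat"
    by (simp add: Q' frame_change_Rmat)
  moreover have "?P ** smult_mat eps ?X ** ctranspose ?P = smult_mat eps Y"
  proof -
    have "?P ** smult_mat eps ?X ** ctranspose ?P = smult_mat eps (?P ** ?X ** ctranspose ?P)"
      by (simp add: vec_eq_iff matrix_mult_nth3 smult_mat_def algebra_simps)
    then show ?thesis
      by (simp add: matrix_mul_assoc unitary_right[OF P] unitary_cancel[OF P])
  qed
  moreover have "?P ** A ** ctranspose ?P = ?P ** B ** ctranspose ?P \<longleftrightarrow> A = B" for A B
    by (metis P unitary_cancel)
  ultimately have "Rmat ** transpose ?X ** matrix_inv Rmat = smult_mat eps ?X \<longleftrightarrow> Y \<in> g1"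
    by (metis g1_iff_Qmat)
  moreover have "- A = smult_mat (- eps) B \<longleftrightarrow> A = smult_mat eps B" for A B
    by (simp add: vec_eq_iff smult_mat_def)
  moreover have "trace ?X = trace Y"
    using trace_mul_sym[of "ctranspose ?P ** Y" ?P]
    by (simp add: matrix_mul_assoc unitary_right[OF P])
  ultimately show ?thesis
    using g1_trace by (auto simp: g1_hat_def)
qed

text \<open>Property (i), by \<open>push_cvelocity\<close> and \<open>g1_hat_conj_iff\<close>.\<close>

lemma push_dist2:
  assumes p: "p \<in> FL2"
  shows "push C1 Phi ` dist2 p = dist1 (Phi p)"
proof (intro equalityI subsetI)
  fix D assume "D \<in> push C1 Phi ` dist2 p"
  then obtain n X where n: "n \<in> N2" "pi2 n = p" and X: "X \<in> g1"
      and D: "D = push C1 Phi (cvelocity C2 pi2 n X)"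
    by (auto simp: dist2_def)
  have "D = cvelocity C1 pi1 (n ** frame_change) (ctranspose frame_change ** X ** frame_change)"
    unfolding D by (rule push_cvelocity[OF n(1) g1_trace[OF X]])
  moreover have "pi1 (n ** frame_change) = Phi p"
    using Phi_pi2 n by auto
  ultimately show "D \<in> dist1 (Phi p)"
    unfolding dist1_def using N2_frame_change[OF n(1)] g1_hat_conj_iff X by blast
next
  fix D assume "D \<in> dist1 (Phi p)"
  then obtain g X where g: "g \<in> SU3" "pi1 g = Phi p" and X: "X \<in> g1_hat" and D: "D = cvelocity C1 pi1 g X"
    by (auto simp: dist1_def)
  define n where "n = g ** ctranspose frame_change"
  define Y where "Y = frame_change ** X ** ctranspose frame_change"
  have n: "n \<in> N2" and g_eq: "g = n ** frame_change"
    using g SU3_frame_change by (simp_all add: n_def unitary_cancel frame_change_unitary)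
  have X_eq: "X = ctranspose frame_change ** Y ** frame_change"
    unfolding Y_def
    by (simp add: matrix_mul_assoc unitary_left unitary_cancel frame_change_unitary)
  have Y: "Y \<in> g1"
    using X g1_hat_conj_iff X_eq by metis
  have "Phi (pi2 n) = Phi p"
    using g(2) by (simp add: Phi_pi2 n g_eq)
  then have "pi2 n = p"
    using Phi_bij p pi2_in_FL2[OF n] by (auto simp: bij_betw_def inj_on_def)
  then have "cvelocity C2 pi2 n Y \<in> dist2 p"
    unfolding dist2_def using n Y by blast
  moreover have "D = push C1 Phi (cvelocity C2 pi2 n Y)"
    unfolding D g_eq X_eq by (rule push_cvelocity[OF n g1_trace[OF Y], symmetric])
  ultimately show "D \<in> push C1 Phi ` dist2 p"
    by blast
qed

section \<open>The two lifts of a special Lagrangian link\<close>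

lemma ctranspose_cols3_mult:
  "(ctranspose (cols3 a b c) ** cols3 a b c)$1$2 = herm a b"
  "(ctranspose (cols3 a b c) ** cols3 a b c)$1$3 = herm a c"
  "(ctranspose (cols3 a b c) ** cols3 a b c)$2$3 = herm b c"
  by (simp_all add: matrix_mult_nth3 herm_def)

text \<open>The plane spanned by \<open>v\<close>, \<open>a\<close>, \<open>b\<close> is special Lagrangian, that is, a real form of \<open>\<complex>\<^sup>3\<close> given by a matrix in
  \<open>SU3\<close>.  So the Hermitian products of these vectors are real, and orthogonality for the
  real inner product gives a unitary frame after rescaling.  Applying the inverse of \<open>P\<close> to that frame turns
  \<open>a\<close> and \<open>b\<close> into multiples of \<open>a - \<i> b\<close> and \<open>-(a + \<i> b)\<close>.\<close>

lemma special_lagrangian_frame: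
  assumes v: "norm v = 1" and orth: "v \<bullet> a = 0" "v \<bullet> b = 0" "a \<bullet> b = 0" and eq: "a \<bullet> a = b \<bullet> b"
    and a: "a \<noteq> 0" and SL: "wedge3 v a b \<in> SL"
  obtains h where "h \<in> SU3" "pi1 h = (v, wedge3 v a b)"
    "pi2 (h ** ctranspose frame_change) = (v, vec.span {v, a - \<i> *s b})"
proof -
  define B where "B = cols3 v a b"
  obtain g where g: "g \<in> SU3" "oplane B = (**) g ` base_plane"
    using SL by (auto simp: SL_def wedge3_def B_def)
  have "B \<in> oplane B"
    unfolding oplane_def by (auto intro!: exI[of _ "mat 1"])
  then have "B \<in> (**) g ` base_plane"
    using g(2) by simp
  then obtain A where A: "B = g ** cplx A" "det A > 0"
    by (auto simp: base_plane_def oplane_def)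
  have "ctranspose B ** B = cplx (transpose A ** A)"
    unfolding A(1) ctranspose_mult cplx_mult ctranspose_cplx[symmetric]
    by (simp add: unitary_cancel[OF SU3_unitary[OF g(1)]] flip: matrix_mul_assoc)
  then have real: "Im ((ctranspose B ** B)$i$j) = 0" for i j
    by simp
  have herm0: "herm v a = 0" "herm v b = 0" "herm a b = 0"
    using real[of 1 2] real[of 1 3] real[of 2 3] orth
    by (simp_all add: B_def ctranspose_cols3_mult complex_eq_iff Re_herm)
  define r where "r = 1 / norm a"
  have r: "r > 0"
    using a by (simp add: r_def)
  have norm_b: "norm b = norm a"
    using eq by (simp add: norm_eq_sqrt_inner)
  define D where "D = (vector [vector [1, 0, 0], vector [0, r, 0], vector [0, 0, r]] :: real^3^3)"
  have det_D: "det D = r * r"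
    by (simp add: D_def det_3)
  define h where "h = B ** cplx D"
  have h_cols: "h = cols3 v (of_real r *s a) (of_real r *s b)"
    by (simp add: h_def B_def D_def mat3_eq_iff matrix_mult_nth3 mult.commute)
  have scale: "herm (of_real r *s x) (of_real r *s y) = of_real (r * r) * herm x y"
    "herm x (of_real r *s y) = of_real r * herm x y"
    "herm (of_real r *s x) y = of_real r * herm x y" for x y
    by (simp_all add: herm_def algebra_simps)
  have "herm v v = 1" "of_real (r * r) * herm a a = 1" "of_real (r * r) * herm b b = 1"
    using v a by (simp_all add: herm_self norm_b r_def power2_eq_square flip: of_real_mult)
  then have h_unitary: "h \<in> unitary_group"
    unfolding h_cols cols3_unitary_iff by (simp add: scale herm0 mult.assoc)
  have h_eq: "h = g ** cplx (A ** D)"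
    by (simp add: h_def A(1) cplx_mult matrix_mul_assoc)
  then have "cplx (A ** D) = ctranspose g ** h"
    by (simp add: unitary_cancel[OF SU3_unitary[OF g(1)]])
  then have "orthogonal_matrix (A ** D)"
    using h_unitary SU3_unitary[OF g(1)]
    by (simp add: unitary_mult unitary_ctranspose flip: cplx_in_unitary_group)
  then have "det (A ** D) = 1 \<or> det (A ** D) = - 1"
    by (rule det_orthogonal_matrix)
  moreover have "det (A ** D) > 0"
    using A(2) r by (simp add: det_mul det_D)
  ultimately have "det (A ** D) = 1"
    by auto
  then have h: "h \<in> SU3"
    using h_unitary g(1) by (simp add: SU3_def h_eq det_mul[of g] det_cplx)
  have "oplane h = oplane B"
    unfolding h_def using r by (intro oplane_mult_real) (simp add: det_D)
  then have pi1_h: "pi1 h = (v, wedge3 v a b)"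
    by (simp add: pi1_def oplane_eq_image[symmetric] wedge3_def B_def[symmetric])
       (simp add: h_cols cols3_e1)
  have "(h ** ctranspose frame_change) *v e1 = v"
    by (simp add: vec_eq_iff matrix_e1 matrix_mult_nth3 frame_change_def h_cols)
  moreover have "(h ** ctranspose frame_change) *v e2 = of_real (r / sqrt 2) *s (a - \<i> *s b)"
    by (simp add: vec_eq_iff matrix_e2 matrix_mult_nth3 frame_change_def h_cols algebra_simps)
  moreover have "vec.span {v, of_real (r / sqrt 2) *s (a - \<i> *s b)} = vec.span {v, a - \<i> *s b}"
    by (rule span_pair_scale) (use r in simp)
  ultimately have "pi2 (h ** ctranspose frame_change) = (v, vec.span {v, a - \<i> *s b})"
    by (simp only: pi2_def)
  with h pi1_h show thesis
    by (rule that)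
qed

lemma chart_inv_left:
  assumes "riemann_surface A" "c \<in> A" "p \<in> fst c"
  shows "chart_inv c (snd c p) = p"
  using assms unfolding riemann_surface_def homeomorphism_def by blast

lemma immersion_differentiable:
  assumes "immersion_S5 A f" "c \<in> A" "p \<in> fst c"
  shows "(f \<circ> chart_inv c) differentiable (at (snd c p))"
proof -
  have "Ck (Suc 0) (chart_image c) (f \<circ> chart_inv c)"
    using assms unfolding immersion_S5_def smooth_on_def by blast
  moreover have "snd c p \<in> chart_image c"
    using assms by (simp add: chart_image_def)
  ultimately show ?thesis
    unfolding Ck.simps by blast
qed

lemma chart_pd_decompose:
  assumes "immersion_S5 A f" "c \<in> A" "p \<in> fst c"
  shows "chart_pd c d f p = Re d *\<^sub>R chart_pd c 1 f p + Im d *\<^sub>R chart_pd c \<i> f p"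
proof -
  let ?L = "frechet_derivative (f \<circ> chart_inv c) (at (snd c p))"
  have L: "linear ?L"
    by (rule linear_frechet_derivative[OF immersion_differentiable[OF assms]])
  have "d = Re d *\<^sub>R 1 + Im d *\<^sub>R \<i>"
    by (simp add: complex_eq_iff)
  then have "?L d = ?L (Re d *\<^sub>R 1 + Im d *\<^sub>R \<i>)"
    by (rule arg_cong)
  then show ?thesis
    unfolding chart_pd_def pd_def by (simp only: linear_add[OF L] linear_cmul[OF L])
qed

text \<open>Differentiate \<open>f \<bullet> f = 1\<close>.\<close>

lemma immersion_S5_orthogonal:
  assumes f: "immersion_S5 A f" "c \<in> A" "p \<in> fst c" and A: "riemann_surface A"
  shows "f p \<bullet> chart_pd c v f p = 0"
proof -
  define G where "G = f \<circ> chart_inv c"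
  define z where "z = snd c p"
  have G: "(G has_derivative frechet_derivative G (at z)) (at z)"
    using immersion_differentiable[OF f] unfolding G_def z_def frechet_derivative_works .
  have Gz: "G z = f p"
    by (simp add: G_def z_def chart_inv_left[OF A f(2,3)])
  have "G w \<bullet> G w = 1" for w
    using f(1) by (simp add: immersion_S5_def G_def dot_square_norm)
  then have "((\<lambda>w. G w \<bullet> G w) has_derivative (\<lambda>v. 0)) (at z)"
    by simp
  moreover have "((\<lambda>w. G w \<bullet> G w) has_derivative
      (\<lambda>v. G z \<bullet> frechet_derivative G (at z) v + frechet_derivative G (at z) v \<bullet> G z)) (at z)"
    by (rule has_derivative_inner[OF G G])
  ultimately have "(\<lambda>v. 0) =
      (\<lambda>v. G z \<bullet> frechet_derivative G (at z) v + frechet_derivative G (at z) v \<bullet> G z)"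
    by (rule has_derivative_unique)
  from fun_cong[OF this, of v] have "G z \<bullet> frechet_derivative G (at z) v = 0"
    by (simp add: inner_commute)
  then show ?thesis
    by (simp add: Gz) (simp add: chart_pd_def pd_def G_def z_def)
qed

text \<open>The coordinate change is holomorphic, so its differential is multiplication by a complex number
  \<open>d\<close>, which is nonzero because \<open>f\<close> is an immersion in the second chart.\<close>

lemma chart_pd_transition:
  assumes A: "riemann_surface A" and f: "immersion_S5 A f" and c: "c \<in> A" "p \<in> fst c"
    and c': "c' \<in> A" "p \<in> fst c'"
  obtains d where "d \<noteq> 0" "\<And>v. chart_pd c' v f p = chart_pd c (d * v) f p"
proof -
  define \<tau> where "\<tau> = snd c \<circ> chart_inv c'"
  define U where "U = snd c' ` (fst c' \<inter> fst c)"
  have hol: "\<tau> holomorphic_on U"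
    using A c c' unfolding riemann_surface_def \<tau>_def U_def by blast
  have opens: "open (fst c)" "open (chart_image c')"
    and homeo: "homeomorphism (fst c') (chart_image c') (snd c') (chart_inv c')"
    using A c c' unfolding riemann_surface_def by blast+
  have "openin (top_of_set (chart_image c')) U"
    unfolding U_def
    by (rule homeomorphism_imp_open_map[OF homeo]) (simp add: openin_open_Int opens)
  then have "open U"
    using opens openin_open_trans by blast
  have p_U: "snd c' p \<in> U"
    using c c' by (auto simp: U_def)
  obtain d where d: "(\<tau> has_field_derivative d) (at (snd c' p))"
    using hol \<open>open U\<close> p_U by (metis holomorphic_on_open)
  have \<tau>_p: "\<tau> (snd c' p) = snd c p"
    by (simp add: \<tau>_def chart_inv_left[OF A c'])
  have "((f \<circ> chart_inv c) has_derivative frechet_derivative (f \<circ> chart_inv c) (at (snd c p))) (at (\<tau> (snd c' p)))"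
    using immersion_differentiable[OF f c] unfolding \<tau>_p frechet_derivative_works .
  from diff_chain_at[OF d[unfolded has_field_derivative_def] this]
  have "((f \<circ> chart_inv c \<circ> \<tau>) has_derivative
      frechet_derivative (f \<circ> chart_inv c) (at (snd c p)) \<circ> (*) d) (at (snd c' p))" .
  then have "((f \<circ> chart_inv c') has_derivative
      frechet_derivative (f \<circ> chart_inv c) (at (snd c p)) \<circ> (*) d) (at (snd c' p))"
  proof (rule has_derivative_transform_within_open[OF _ \<open>open U\<close> p_U])
    show "(f \<circ> chart_inv c \<circ> \<tau>) w = (f \<circ> chart_inv c') w" if "w \<in> U" for w
      using that chart_inv_left[OF A c(1)] chart_inv_left[OF A c'(1)] by (auto simp: U_def \<tau>_def)
  qed
  from frechet_derivative_at[OF this]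
  have pd: "chart_pd c' v f p = chart_pd c (d * v) f p" for v
    by (simp add: chart_pd_def pd_def fun_eq_iff)
  have "d \<noteq> 0"
  proof
    assume "d = 0"
    then have "chart_pd c' 1 f p = chart_pd c' 0 f p"
      using pd[of 0] pd[of 1] by simp
    moreover have "inj (\<lambda>v. chart_pd c' v f p)"
      using f c' unfolding immersion_S5_def by blast
    ultimately show False
      by (metis injD zero_neq_one)
  qed
  then show thesis
    using that pd by blast
qed

text \<open>Multiplication by \<open>d\<close> acts on the pair \<open>f\<^sub>x\<close>, \<open>f\<^sub>y\<close> by a real matrix with determinant \<open>\<bar>d\<bar>\<^sup>2 > 0\<close>, and on
  \<open>f\<^sub>z\<close> as the scalar \<open>d\<close>.\<close>

lemma chart_independence:
  assumes A: "riemann_surface A" and f: "immersion_S5 A f" and c: "c \<in> A" "p \<in> fst c"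
    and c': "c' \<in> A" "p \<in> fst c'"
  shows "wedge3 v (chart_pd c' 1 f p) (chart_pd c' \<i> f p) = wedge3 v (chart_pd c 1 f p) (chart_pd c \<i> f p)"
    and "vec.span {f_z c' f p} = vec.span {f_z c f p}"
proof -
  obtain d where d: "d \<noteq> 0" "\<And>v. chart_pd c' v f p = chart_pd c (d * v) f p"
    by (rule chart_pd_transition[OF assms]) (rule that)
  define x y where "x = chart_pd c 1 f p" and "y = chart_pd c \<i> f p"
  define s t where "s = Re d" and "t = Im d"
  have d_eq: "d = of_real s + \<i> * of_real t"
    unfolding s_def t_def by (rule complex_eq)
  have "chart_pd c' 1 f p = chart_pd c d f p" "chart_pd c' \<i> f p = chart_pd c (d * \<i>) f p"
    using d(2)[of 1] d(2)[of \<i>] by simp_all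
  moreover have "chart_pd c d f p = s *\<^sub>R x + t *\<^sub>R y"
    unfolding chart_pd_decompose[OF f c, of d] x_def y_def s_def t_def ..
  moreover have "chart_pd c (d * \<i>) f p = (- t) *\<^sub>R x + s *\<^sub>R y"
    unfolding chart_pd_decompose[OF f c, of "d * \<i>"] x_def y_def s_def t_def by simp
  ultimately have x': "chart_pd c' 1 f p = s *\<^sub>R x + t *\<^sub>R y"
    and y': "chart_pd c' \<i> f p = (- t) *\<^sub>R x + s *\<^sub>R y"
    by (simp_all only:)
  define B where "B = (vector [vector [1, 0, 0], vector [0, s, - t], vector [0, t, s]] :: real^3^3)"
  have "det B = s\<^sup>2 + t\<^sup>2"
    by (simp add: B_def det_3 power2_eq_square)
  then have "det B > 0"
    using d(1) by (simp add: sum_power2_gt_zero_iff d_eq) auto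
  moreover have "cols3 v (chart_pd c' 1 f p) (chart_pd c' \<i> f p) = cols3 v x y ** cplx B"
    unfolding x' y' B_def
    by (simp add: mat3_eq_iff matrix_mult_nth3 scaleR_conv_of_real[where 'a = complex] mult.commute)
  ultimately show "wedge3 v (chart_pd c' 1 f p) (chart_pd c' \<i> f p) = wedge3 v (chart_pd c 1 f p) (chart_pd c \<i> f p)"
    unfolding wedge3_def x_def[symmetric] y_def[symmetric] by (simp add: oplane_mult_real)
  have "f_z c' f p = d *s f_z c f p"
    unfolding f_z_def x' y' x_def[symmetric] y_def[symmetric]
    unfolding d_eq by (simp add: vec_eq_iff scaleR_conv_of_real[where 'a = complex] algebra_simps)
  then show "vec.span {f_z c' f p} = vec.span {f_z c f p}"
    using span_pair_scale[OF d(1), of 0 "f_z c f p"] by (simp only: vec.span_insert_0)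
qed

lemma psi1_eq:
  assumes A: "riemann_surface A" and f: "immersion_S5 A f" and c: "c \<in> A" "p \<in> fst c"
  shows "psi1 A f p = (f p, wedge3 (f p) (chart_pd c 1 f p) (chart_pd c \<i> f p))"
proof -
  have "(THE V. \<exists>c\<in>A. p \<in> fst c \<and> V = wedge3 (f p) (chart_pd c 1 f p) (chart_pd c \<i> f p)) =
      wedge3 (f p) (chart_pd c 1 f p) (chart_pd c \<i> f p)"
  proof (rule the_equality)
    fix V assume "\<exists>c\<in>A. p \<in> fst c \<and> V = wedge3 (f p) (chart_pd c 1 f p) (chart_pd c \<i> f p)"
    then obtain c' where c': "c' \<in> A" "p \<in> fst c'"
        and V: "V = wedge3 (f p) (chart_pd c' 1 f p) (chart_pd c' \<i> f p)"
      by blast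
    show "V = wedge3 (f p) (chart_pd c 1 f p) (chart_pd c \<i> f p)"
      unfolding V by (rule chart_independence(1)[OF A f c c'])
  qed (use c in blast)
  then show ?thesis
    by (simp add: psi1_def)
qed

lemma psi2_eq:
  assumes A: "riemann_surface A" and f: "immersion_S5 A f" and c: "c \<in> A" "p \<in> fst c"
  shows "psi2 A f p = (f p, vec.span {f p, chart_pd c 1 f p - \<i> *s chart_pd c \<i> f p})"
proof -
  have sum: "{a + b | a b. a \<in> vec.span {f p} \<and> b \<in> vec.span {u}} = vec.span {f p, u}" for u
    unfolding span_pair vec.span_singleton by auto
  have "(THE W. \<exists>c\<in>A. p \<in> fst c \<and>
      W = {a + b | a b. a \<in> vec.span {f p} \<and> b \<in> vec.span {f_z c f p}}) =
      {a + b | a b. a \<in> vec.span {f p} \<and> b \<in> vec.span {f_z c f p}}"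
  proof (rule the_equality)
    fix W assume "\<exists>c\<in>A. p \<in> fst c \<and>
      W = {a + b | a b. a \<in> vec.span {f p} \<and> b \<in> vec.span {f_z c f p}}"
    then obtain c' where c': "c' \<in> A" "p \<in> fst c'"
        and W: "W = {a + b | a b. a \<in> vec.span {f p} \<and> b \<in> vec.span {f_z c' f p}}"
      by blast
    show "W = {a + b | a b. a \<in> vec.span {f p} \<and> b \<in> vec.span {f_z c f p}}"
      unfolding W chart_independence(2)[OF A f c c'] ..
  qed (use c in blast)
  moreover have "vec.span {f p, f_z c f p} =
      vec.span {f p, chart_pd c 1 f p - \<i> *s chart_pd c \<i> f p}"
    unfolding f_z_def by (rule span_pair_scale) simp
  ultimately show ?thesis
    unfolding psi2_def sum by simp
qed

text \<open>Property (ii): the frame \<open>h\<close> of \<open>special_lagrangian_frame\<close> is a lift of \<open>\<psi>\<^sub>1\<close> at \<open>p\<close>, and \<open>h P\<^sup>*\<close> is one of \<open>\<psi>\<^sub>2\<close>.\<close>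

lemma psi_link:
  assumes A: "riemann_surface A" and f: "immersion_S5 A f" "conformal A f" "sl_link A f"
  shows "psi2 A f p \<in> FL2" "psi1 A f p \<in> FL1" "psi1 A f p = Phi (psi2 A f p)"
proof -
  obtain c where c: "c \<in> A" "p \<in> fst c"
    using A unfolding riemann_surface_def by blast
  let ?a = "chart_pd c 1 f p" and ?b = "chart_pd c \<i> f p"
  have "norm (f p) = 1" "inj (\<lambda>v. chart_pd c v f p)"
    using f(1) c unfolding immersion_S5_def by blast+
  moreover have "chart_pd c 0 f p = 0"
    using chart_pd_decompose[OF f(1) c, of 0] by simp
  ultimately have "?a \<noteq> 0"
    by (metis injD zero_neq_one)
  have "?a \<bullet> ?a = ?b \<bullet> ?b" "?a \<bullet> ?b = 0"
    using f(2) c unfolding conformal_def by blast+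
  moreover have "wedge3 (f p) ?a ?b \<in> SL"
    using f(3) c unfolding sl_link_def by blast
  ultimately obtain h where h: "h \<in> SU3" "pi1 h = (f p, wedge3 (f p) ?a ?b)"
      "pi2 (h ** ctranspose frame_change) = (f p, vec.span {f p, ?a - \<i> *s ?b})"
    using special_lagrangian_frame \<open>norm (f p) = 1\<close> \<open>?a \<noteq> 0\<close> immersion_S5_orthogonal[OF f(1) c A]
    by metis
  have psi: "psi1 A f p = pi1 h" "psi2 A f p = pi2 (h ** ctranspose frame_change)"
    by (simp_all add: psi1_eq[OF A f(1) c] psi2_eq[OF A f(1) c] h)
  show "psi2 A f p \<in> FL2" "psi1 A f p \<in> FL1" "psi1 A f p = Phi (psi2 A f p)"
    unfolding psi using h(1)
    by (simp_all add: pi1_in_FL1 pi2_in_FL2 SU3_frame_change Phi_pi2 unitary_cancel frame_change_unitary)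
qed

theorem proposition3:
  shows "diffeomorphism C2 FL2 C1 FL1 Phi \<and>
    (\<forall>g\<in>SU3. \<forall>p\<in>FL2. Phi (act2 g p) = act1 g (Phi p)) \<and>
    k_symmetric 6 SU3 K1 sigma_hat \<and>
    (\<forall>p\<in>FL2. push C1 Phi ` dist2 p = dist1 (Phi p)) \<and>
    (\<forall>(A :: 'm::{t2_space, second_countable_topology} chart set) f.
       riemann_surface A \<and> connected (UNIV :: 'm set) \<and>
       immersion_S5 A f \<and> conformal A f \<and> legendrian A f \<and> minimal A f \<and> sl_link A f \<longrightarrow>
       range (psi1 A f) \<subseteq> FL1 \<and> range (psi2 A f) \<subseteq> FL2 \<and>
       psi1 A f = Phi \<circ> psi2 A f \<and>
       (primitive C2 FL2 dist2 A (psi2 A f) \<longrightarrow> primitive C1 FL1 dist1 A (psi1 A f)) \<and>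
       (primitive_harmonic C2 FL2 act2 dist2 A (psi2 A f) \<longrightarrow>
        primitive_harmonic C1 FL1 act1 dist1 A (psi1 A f)))"
proof (intro conjI ballI allI impI)
  show "diffeomorphism C2 FL2 C1 FL1 Phi"
    by (rule Phi_diffeomorphism)
  show "Phi (act2 g p) = act1 g (Phi p)" if "g \<in> SU3" "p \<in> FL2" for g p
    using that by (rule Phi_equivariant)
  show "k_symmetric 6 SU3 K1 sigma_hat"
    by (rule sigma_hat_6_symmetric)
  show "push C1 Phi ` dist2 p = dist1 (Phi p)" if "p \<in> FL2" for p
    using that by (rule push_dist2)
next
  fix A :: "'m chart set" and f
  assume asm: "riemann_surface A \<and> connected (UNIV :: 'm set) \<and>
       immersion_S5 A f \<and> conformal A f \<and> legendrian A f \<and> minimal A f \<and> sl_link A f"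
  then have psi: "psi2 A f p \<in> FL2" "psi1 A f p \<in> FL1" "psi1 A f p = Phi (psi2 A f p)" for p
    using psi_link[of A f p] by auto
  then show "range (psi1 A f) \<subseteq> FL1" "range (psi2 A f) \<subseteq> FL2"
    by auto
  show psi1: "psi1 A f = Phi \<circ> psi2 A f"
    by (rule ext) (simp add: psi(3))
  show "primitive C1 FL1 dist1 A (psi1 A f)" if "primitive C2 FL2 dist2 A (psi2 A f)"
    unfolding psi1 by (rule Phi.primitive_compose[OF push_dist2 that])
  show "primitive_harmonic C1 FL1 act1 dist1 A (psi1 A f)"
    if "primitive_harmonic C2 FL2 act2 dist2 A (psi2 A f)"
    unfolding psi1
    by (rule Phi.primitive_harmonic_compose[OF push_dist2 Phi_equivariant C2_act2 C1_act1 that])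
qed

end
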